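(* Let $n\ge 1$. Let $a\ge n$ (and $a>1$ if $n=1$) and let $W:\mathbb{R}^n\to(0,+\infty)$ be such that $\int_{\mathbb{R}^n} W^{1-a}<+\infty$. Then for any positive and smooth function $g$ on $\mathbb{R}^n$ such that $\int_{\mathbb{R}^n} W^*(\nabla g)\,g^{-a}<+\infty$, $\int_{\mathbb{R}^n} g^{1-a}<+\infty$ and $$\int_{\mathbb{R}^n} g^{-a}=\int_{\mathbb{R}^n} W^{-a}=1,$$ one has $$(a-1)\int_{\mathbb{R}^n} W^*(\nabla g)\,g^{-a}+(a-n)\int_{\mathbb{R}^n} g^{1-a}\ \ge\ \int_{\mathbb{R}^n} W^{1-a},$$ with equality if $g=W$ and is convex.
   Context: All integrals are with respect to Lebesgue measure. For a function $W:\mathbb{R}^n\to\mathbb{R}\cup\{+\infty\}$, $W^*$ denotes its Legendre transform, $W^*(y)=\sup_{x\in\mathbb{R}^n}\{x\cdot y-W(x)\}$, $y\in\mathbb{R}^n$. *)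

theory Defs
  imports "HOL-Analysis.Analysis"
begin

text \<open>
  For \<open>W x = \<infinity>\<close> the term \<open>ereal (x \<bullet> y) - W x\<close> is \<open>-\<infinity>\<close>, so points outside the domain of
  \<open>W\<close> do not contribute to the supremum.
\<close>
definition legendre :: "('a::real_inner \<Rightarrow> ereal) \<Rightarrow> 'a \<Rightarrow> ereal" where
  "legendre W y = (SUP x. ereal (x \<bullet> y) - W x)"

text \<open>Determined by \<^const>\<open>gderiv\<close> wherever \<open>f\<close> is differentiable.\<close>
definition grad :: "('a::real_inner \<Rightarrow> real) \<Rightarrow> 'a \<Rightarrow> 'a" where
  "grad f x = (THE D. GDERIV f x :> D)"

primrec Ck :: "nat \<Rightarrow> ('a::real_normed_vector \<Rightarrow> real) \<Rightarrow> bool" where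
  "Ck 0 f \<longleftrightarrow> continuous_on UNIV f"
| "Ck (Suc k) f \<longleftrightarrow> (\<forall>x. f differentiable (at x)) \<and> (\<forall>v. Ck k (\<lambda>x. frechet_derivative f (at x) v))"

definition smooth :: "('a::real_normed_vector \<Rightarrow> real) \<Rightarrow> bool" where
  "smooth f \<longleftrightarrow> (\<forall>k. Ck k f)"

text \<open>
  The integral of a measurable extended-real function, as the difference of the integrals of
  its positive and negative parts (\<^const>\<open>e2ennreal\<close> sends negative values to \<open>0\<close>). When both
  parts have infinite integral, the value is \<open>\<infinity> - \<infinity> = \<infinity>\<close>; hence \<open>ereal_integral M f < \<infinity>\<close>
  says that the positive part has finite integral, and then the integral is well defined.
\<close>
definition ereal_integral :: "'a measure \<Rightarrow> ('a \<Rightarrow> ereal) \<Rightarrow> ereal" where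
  "ereal_integral M f =
     enn2ereal (\<integral>\<^sup>+x. e2ennreal (f x) \<partial>M) - enn2ereal (\<integral>\<^sup>+x. e2ennreal (- f x) \<partial>M)"

lemma ereal_integral_eq_lebesgue_integral:
  assumes "integrable M f"
  shows "ereal_integral M (\<lambda>x. ereal (f x)) = ereal (integral\<^sup>L M f)"
proof -
  have fin: "(\<integral>\<^sup>+x. ennreal (f x) \<partial>M) < \<infinity>" "(\<integral>\<^sup>+x. ennreal (- f x) \<partial>M) < \<infinity>"
    using assms by (auto simp: real_integrable_def top.not_eq_extremum)
  have conv: "enn2ereal t = ereal (enn2real t)" if "t < \<infinity>" for t :: ennreal
    using that by (cases t rule: ennreal_cases) auto
  show ?thesis
    using conv[OF fin(1)] conv[OF fin(2)] real_lebesgue_integral_def[OF assms]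
    by (simp add: ereal_integral_def flip: ennreal.abs_eq)
qed

end

theory Submission
  imports Defs "HOL-Probability.Probability" "HOL-Real_Asymp.Real_Asymp"
begin

text \<open>
  Let \<open>T\<close> transport the density \<open>g powr -a\<close> to \<open>W powr -a\<close>, the latter restricted to a bounded set and
  normalised by its mass \<open>m\<close>. For the Knothe map, \<open>T i\<close> is monotone in the \<open>i\<close>-th coordinate, and the
  product of the diagonal derivatives \<open>t i\<close> is the quotient of the densities, that is
  \<open>m * (W (T x) / g x) powr a\<close>. Since \<open>n \<le> a\<close>, the weighted AM-GM inequality bounds \<open>a\<close> times the
  \<open>a\<close>-th root of this product by \<open>a - n + (\<Sum>i. t i)\<close>. Multiplying by \<open>g powr (1 - a)\<close>, integrating by
  parts and using \<open>T x \<bullet> grad g x \<le> W (T x) + legendre W (grad g x)\<close> gives the claim as the bounded set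
  exhausts the space.

  No regularity of \<open>W\<close> is needed: all that is used of the derivatives \<open>t i\<close> is that the pointwise
  derivative of a monotone function is at most its distributional derivative. As the target is
  bounded, so is \<open>T\<close>, which makes the boundary terms of the cut-off vanish in the limit. If \<open>g = W\<close> is
  convex, then \<open>legendre W (grad g x) = x \<bullet> grad g x - g x\<close>, and equality is the divergence theorem for
  the vector field \<open>g x powr (1 - a) *\<^sub>R x\<close>.
\<close>

section \<open>Monotone transport on the line\<close>

text \<open>The root of \<open>m * (W (T x) / g x) powr a\<close> is
  \<open>m powr (1 / a) * (W (T x) / g x)\<close>, so the weight \<open>g powr (1 - a)\<close>
  leaves \<open>W (T x) * g x powr (- a)\<close>. Its integral is known from push-forward alone: it
  is the mean \<open>A\<close> of \<open>W\<close> under the normalised target density. The gradient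
  of the weight is \<open>(1 - a) * g powr (- a)\<close> times that of \<open>g\<close>, hence the
  factor \<open>a - 1\<close>. So \<open>A\<close> stands \<open>a * m powr (1 / a)\<close> times on
  the left and, through Young's inequality, \<open>a - 1\<close> times on the right; as
  \<open>m\<close> tends to 1, one copy remains. No transport map is ever differentiated:
  \<open>t i\<close> is defined as a quotient of conditional densities. The product formula is then
  algebra, and the bound by the distributional derivative is a layer-cake computation on the line.
  This is what the Knothe map, built from monotone maps of the line, offers. The obstacle is
  integrability and measurability: \<open>W\<close> is only Lebesgue measurable, and the hypothesis
  on the Legendre transform controls only a positive part. Finiteness of the negative part has to
  come out of the transport argument itself.\<close>

definition dens_cdf :: "(real \<Rightarrow> real) \<Rightarrow> real \<Rightarrow> real" where
  "dens_cdf q y = enn2real (\<integral>\<^sup>+z. ennreal (q z) * indicator {..y} z \<partial>lborel)"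

text \<open>
  The set is the interval \<open>{-r..<y}\<close>, where \<open>y\<close> is the least point at which the distribution functions
  agree. Measuring it instead of taking an infimum makes measurability in parameters follow from Fubini.
\<close>

definition mono_transport :: "(real \<Rightarrow> real) \<Rightarrow> (real \<Rightarrow> real) \<Rightarrow> real \<Rightarrow> real \<Rightarrow> real" where
  "mono_transport p q r s = measure lborel {y\<in>{-r..r}. dens_cdf q y < dens_cdf p s} - r"

lemma integral_deriv_compact_support:
  fixes u v :: "real \<Rightarrow> real"
  assumes u_deriv: "\<And>x. (u has_real_derivative v x) (at x)" and v_cont: "continuous_on UNIV v"
    and supp: "\<And>x. B < \<bar>x\<bar> \<Longrightarrow> u x = 0" "\<And>x. B < \<bar>x\<bar> \<Longrightarrow> v x = 0"
  shows "(\<integral>z. indicator {x<..} z * v z \<partial>lborel) = - u x"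
    and "(\<integral>z. v z \<partial>lborel) = 0"
proof -
  have [measurable]: "v \<in> borel_measurable borel"
    using v_cont by (rule borel_measurable_continuous_onI)
  show ftc: "(\<integral>z. indicator {x<..} z * v z \<partial>lborel) = - u x" for x
  proof -
    define b where "b = max x (max B 0 + 1)"
    have b: "x \<le> b" "B < b" "0 \<le> b" by (auto simp: b_def)
    have "(\<integral>z. indicator {x<..} z * v z \<partial>lborel) = (\<integral>z. indicator {x..b} z *\<^sub>R v z \<partial>lborel)"
      by (rule integral_cong_AE)
         (use AE_lborel_singleton[of x] b in \<open>auto simp: indicator_def supp(2) elim!: eventually_mono\<close>)
    also have "\<dots> = u b - u x"
      using b by (intro integral_FTC_Icc)
        (auto intro: DERIV_subset[OF u_deriv] continuous_on_subset[OF v_cont]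
          simp: has_real_derivative_iff_has_vector_derivative[symmetric])
    also have "u b = 0" using b by (intro supp) auto
    finally show ?thesis by simp
  qed
  have "(\<integral>z. v z \<partial>lborel) = (\<integral>z. indicator {-\<bar>B\<bar> - 1<..} z * v z \<partial>lborel)"
    by (rule Bochner_Integration.integral_cong) (auto simp: indicator_def supp(2))
  also have "\<dots> = 0" unfolding ftc by (simp add: supp)
  finally show "(\<integral>z. v z \<partial>lborel) = 0" .
qed

section \<open>Distribution functions of densities on the line\<close>

locale prob_density =
  fixes q :: "real \<Rightarrow> real"
  assumes q_meas [measurable]: "q \<in> borel_measurable borel"
    and q_int: "(\<integral>\<^sup>+z. ennreal (q z) \<partial>lborel) = 1"
begin

definition "Q = density lborel (\<lambda>z. ennreal (q z))"

lemma real_distribution_Q: "real_distribution Q"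
proof -
  interpret prob_space Q
    by standard (use q_int in \<open>simp add: Q_def emeasure_density\<close>)
  show ?thesis by standard (simp add: Q_def)
qed

sublocale Q: real_distribution Q
  by (rule real_distribution_Q)

lemma cdf_Q: "cdf Q = dens_cdf q"
  unfolding cdf_def dens_cdf_def Q_def measure_def
  by (subst emeasure_density) auto

lemma dens_cdf_mono: "x \<le> y \<Longrightarrow> dens_cdf q x \<le> dens_cdf q y"
  using Q.cdf_nondecreasing by (simp add: cdf_Q)

lemma dens_cdf_nonneg: "0 \<le> dens_cdf q x"
  and dens_cdf_le1: "dens_cdf q x \<le> 1"
  using Q.cdf_nonneg Q.cdf_bounded_prob by (simp_all add: cdf_Q)

lemma isCont_dens_cdf: "isCont (dens_cdf q) x"
proof -
  have "emeasure Q {x} = (\<integral>\<^sup>+z. ennreal (q z) * indicator {x} z \<partial>lborel)"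
    unfolding Q_def by (subst emeasure_density) auto
  also have "\<dots> = (\<integral>\<^sup>+(z::real). 0 \<partial>lborel)"
    by (rule nn_integral_cong_AE)
      (use AE_lborel_singleton[of x] in eventually_elim, auto simp: indicator_def)
  finally have "measure Q {x} = 0" by (simp add: measure_def)
  then show ?thesis using Q.isCont_cdf by (simp add: cdf_Q)
qed

lemma dens_cdf_at_top: "(dens_cdf q \<longlongrightarrow> 1) at_top"
  and dens_cdf_at_bot: "(dens_cdf q \<longlongrightarrow> 0) at_bot"
  using Q.cdf_lim_at_top_prob Q.cdf_lim_at_bot by (simp_all add: cdf_Q)

lemma dens_cdf_attained:
  assumes "0 < c" "c < 1"
  obtains x where "dens_cdf q x = c"
proof -
  obtain u where u: "dens_cdf q u < c"
    using order_tendstoD(2)[OF dens_cdf_at_bot assms(1)] by (auto simp: eventually_at_bot_linorder)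
  obtain w where w: "c < dens_cdf q w"
    using order_tendstoD(1)[OF dens_cdf_at_top assms(2)] by (auto simp: eventually_at_top_linorder)
  have "u \<le> w" using u w dens_cdf_mono[of w u] by linarith
  then have "\<exists>x\<ge>u. x \<le> w \<and> dens_cdf q x = c"
    using u w by (intro IVT) (auto intro: isCont_dens_cdf)
  then show thesis using that by blast
qed

lemma dens_cdf_measurable [measurable]: "dens_cdf q \<in> borel_measurable borel"
  by (intro borel_measurable_continuous_onI continuous_at_imp_continuous_on ballI isCont_dens_cdf)

end

locale pos_prob_density = prob_density p for p +
  assumes p_pos: "0 < p x"
begin

lemma dens_cdf_strict_mono:
  assumes "x < y" shows "dens_cdf p x < dens_cdf p y"
proof -
  have "dens_cdf p y - dens_cdf p x = measure Q {x<..y}"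
    using Q.cdf_diff_eq[OF assms] by (simp add: cdf_Q)
  moreover have "emeasure Q {x<..y} \<noteq> 0"
  proof
    assume "emeasure Q {x<..y} = 0"
    then have "(\<integral>\<^sup>+z. ennreal (p z) * indicator {x<..y} z \<partial>lborel) = 0"
      unfolding Q_def by (subst (asm) emeasure_density) auto
    then have "AE z in lborel. ennreal (p z) * indicator {x<..y} z = 0"
      by (subst (asm) nn_integral_0_iff_AE) auto
    then have "AE z in lborel. z \<notin> {x<..y}"
      by eventually_elim (use p_pos in \<open>auto simp: indicator_def ennreal_eq_0_iff simp flip: not_le split: if_splits\<close>)
    then have "emeasure lborel {x<..y} = 0"
      by (subst (asm) AE_iff_measurable[where N="{x<..y}"]) auto
    then show False using assms by simp
  qed
  ultimately show ?thesis
    by (metis Q.emeasure_eq_measure diff_gt_0_iff_gt ennreal_0 measure_nonneg order_le_less)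
qed

lemma dens_cdf_less_iff: "dens_cdf p x < dens_cdf p y \<longleftrightarrow> x < y"
  using dens_cdf_strict_mono by (metis linorder_neqE less_asym less_irrefl)

lemma dens_cdf_gt_0: "0 < dens_cdf p x"
  using dens_cdf_strict_mono[of "x-1" x] dens_cdf_nonneg[of "x-1"] by linarith

text \<open>The distribution function of a positive density is uniformly distributed under it: it is
  continuous and strictly increasing, so its sublevel set at \<open>c\<close> is a half-line whose
  end point has value \<open>c\<close>, or trivial if \<open>c\<close> is 0 or 1. This yields the
  law of the transport map.\<close>

lemma measure_dens_cdf_le:
  assumes "0 \<le> c" "c \<le> 1"
  shows "measure Q {x. dens_cdf p x \<le> c} = c"
proof -
  consider "c = 0" | "c = 1" | "0 < c" "c < 1" using assms by linarith
  then show ?thesis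
  proof cases
    case 1
    then have "{x. dens_cdf p x \<le> c} = {}" using dens_cdf_gt_0 by (auto simp: not_le)
    then show ?thesis using 1 by simp
  next
    case 2
    then have "{x. dens_cdf p x \<le> c} = UNIV" using dens_cdf_le1 by auto
    then show ?thesis using 2 Q.prob_space by simp
  next
    case 3
    then obtain x0 where x0: "dens_cdf p x0 = c" by (rule dens_cdf_attained)
    have "{x. dens_cdf p x \<le> c} = {..x0}"
      using dens_cdf_less_iff x0 by (auto simp flip: not_less)
    then show ?thesis using x0 by (simp add: cdf_Q[symmetric] cdf_def)
  qed
qed

end

section \<open>The monotone map between two densities\<close>

locale transport_pair = P: pos_prob_density p + Q: prob_density q for p q +
  fixes r :: real
  assumes q_supp: "r < \<bar>y\<bar> \<Longrightarrow> q y = 0"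
begin

abbreviation "F \<equiv> dens_cdf q"
abbreviation "R \<equiv> dens_cdf p"
abbreviation "T \<equiv> mono_transport p q r"

lemma F_below: "y < -r \<Longrightarrow> F y = 0"
proof -
  assume y: "y < -r"
  have "(\<integral>\<^sup>+z. ennreal (q z) * indicator {..y} z \<partial>lborel) = (\<integral>\<^sup>+(z::real). 0 \<partial>lborel)"
    by (rule nn_integral_cong) (use y q_supp in \<open>auto simp: indicator_def\<close>)
  then show "F y = 0" by (simp add: dens_cdf_def)
qed

lemma F_above: "r \<le> y \<Longrightarrow> F y = 1"
proof -
  assume y: "r \<le> y"
  have "(\<integral>\<^sup>+z. ennreal (q z) * indicator {..y} z \<partial>lborel) = (\<integral>\<^sup>+z. ennreal (q z) \<partial>lborel)"
    by (rule nn_integral_cong) (use y in \<open>auto simp: indicator_def not_le q_supp\<close>)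
  then show "F y = 1" by (simp add: dens_cdf_def Q.q_int)
qed

lemma r_nonneg: "0 \<le> r"
proof (rule ccontr)
  assume "\<not> 0 \<le> r"
  then have "F r = 0" "F r = 1"
    using F_below[of r] F_above[of r] by auto
  then show False by simp
qed

text \<open>\<open>T x\<close> is the generalised inverse of \<open>F\<close> at \<open>R x\<close>.
  The candidates in \<open>{-r..r}\<close> form a compact set containing \<open>r\<close>, so there
  is a least one; points below \<open>-r\<close> never qualify because \<open>F\<close> is 0 there
  while \<open>R x\<close> is positive. The equivalence in the last clause carries monotonicity, the
  law of \<open>T\<close> and \<open>F_T\<close>.\<close>

lemma mono_transport_props:
  shows "{y\<in>{-r..r}. F y < R x} = {-r..<T x}" "T x \<in> {-r..r}"
    and "T x \<le> y \<longleftrightarrow> R x \<le> F y"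
proof -
  let ?C = "{-r..r} \<inter> {y. R x \<le> F y}"
  have contF: "continuous_on UNIV F"
    by (intro continuous_at_imp_continuous_on ballI Q.isCont_dens_cdf)
  have "closed {y. R x \<le> F y}"
    by (intro closed_Collect_le continuous_on_const contF)
  then have "compact ?C" by (intro compact_Int_closed) auto
  moreover have "r \<in> ?C" using r_nonneg F_above[of r] P.dens_cdf_le1 by auto
  ultimately obtain y0 where y0: "y0 \<in> ?C" "\<And>y. y \<in> ?C \<Longrightarrow> y0 \<le> y"
    using compact_attains_inf[of ?C] by blast
  have gal: "y0 \<le> y \<longleftrightarrow> R x \<le> F y" for y
  proof
    assume "y0 \<le> y"
    then have "F y0 \<le> F y" by (rule Q.dens_cdf_mono)
    then show "R x \<le> F y" using y0(1) by simp
  next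
    assume a: "R x \<le> F y"
    have "-r \<le> y"
    proof (rule ccontr)
      assume "\<not> -r \<le> y"
      then have "F y = 0" by (intro F_below) simp
      then show False using a P.dens_cdf_gt_0[of x] by simp
    qed
    show "y0 \<le> y"
    proof (cases "y \<le> r")
      case True
      then show ?thesis using a \<open>-r \<le> y\<close> by (intro y0(2)) simp
    next
      case False
      then show ?thesis using y0(1) by simp
    qed
  qed
  have set: "{y\<in>{-r..r}. F y < R x} = {-r..<y0}"
  proof -
    have "F y < R x \<longleftrightarrow> y < y0" for y
      unfolding not_le[symmetric] gal[of y] ..
    moreover have "y0 \<le> r" using y0(1) by simp
    ultimately show ?thesis by (intro set_eqI) (simp, linarith)
  qed
  have "T x = y0"
    unfolding mono_transport_def set using y0(1) by (simp add: measure_def)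
  then show "{y\<in>{-r..r}. F y < R x} = {-r..<T x}" "T x \<in> {-r..r}" "T x \<le> y \<longleftrightarrow> R x \<le> F y"
    using set y0(1) gal[of y] by (simp_all only: Int_iff)
qed

lemma T_abs: "\<bar>T x\<bar> \<le> r"
  using mono_transport_props(2)[of x] by auto

text \<open>Left of \<open>T x\<close> the values of \<open>F\<close> stay below \<open>R x\<close>
  by minimality, and since \<open>F\<close> has no jumps this bound passes to the limit at
  \<open>T x\<close>.\<close>

lemma F_T: "F (T x) = R x"
proof (rule antisym)
  show "R x \<le> F (T x)" using mono_transport_props(3)[of x "T x"] by simp
  have "(F \<longlongrightarrow> F (T x)) (at_left (T x))"
    using Q.isCont_dens_cdf[of "T x"] unfolding isCont_def
    by (rule tendsto_mono[rotated]) (simp add: at_within_le_at)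
  moreover have "eventually (\<lambda>y. F y \<le> R x) (at_left (T x))"
  proof (rule eventually_at_leftI[of "T x - 1"])
    fix y assume "y \<in> {T x - 1<..<T x}"
    then show "F y \<le> R x" using mono_transport_props(3)[of x y] by simp
  qed simp
  ultimately show "F (T x) \<le> R x"
    by (intro tendsto_upperbound) auto
qed

lemma mono_T: "mono T"
  by (intro monoI) (simp add: mono_transport_props(3) F_T P.dens_cdf_mono)

lemma T_measurable [measurable]: "T \<in> borel_measurable borel"
  by (rule borel_measurable_mono[OF mono_T])

text \<open>Comparing distribution functions suffices: the equivalence for
  \<open>T x \<le> y\<close> turns the preimage of \<open>{..y}\<close> into a sublevel set of
  \<open>R\<close>, which has mass \<open>F y\<close>.\<close>

lemma distr_T: "distr P.Q borel T = Q.Q"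
proof (rule cdf_unique)
  show "real_distribution (distr P.Q borel T)"
    by (rule P.Q.real_distribution_distr) simp
  show "real_distribution Q.Q" by (rule Q.real_distribution_Q)
  show "cdf (distr P.Q borel T) = cdf Q.Q"
  proof
    fix y
    have "cdf (distr P.Q borel T) y = measure P.Q (T -` {..y})"
      by (simp add: cdf_def measure_distr)
    also have "T -` {..y} = {x. R x \<le> F y}" using mono_transport_props(3) by auto
    also have "measure P.Q \<dots> = F y"
      using Q.dens_cdf_nonneg Q.dens_cdf_le1 by (rule P.measure_dens_cdf_le)
    finally show "cdf (distr P.Q borel T) y = cdf Q.Q y" by (simp add: Q.cdf_Q)
  qed
qed

lemma nn_integral_T:
  assumes [measurable]: "h \<in> borel_measurable borel"
  shows "(\<integral>\<^sup>+x. h (T x) * ennreal (p x) \<partial>lborel) = (\<integral>\<^sup>+y. h y * ennreal (q y) \<partial>lborel)"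
proof -
  have "(\<integral>\<^sup>+x. h (T x) * ennreal (p x) \<partial>lborel) = (\<integral>\<^sup>+x. h (T x) \<partial>P.Q)"
    by (simp add: P.Q_def nn_integral_density mult.commute)
  also have "\<dots> = (\<integral>\<^sup>+x. h x \<partial>distr P.Q borel T)"
    by (subst nn_integral_distr) auto
  also have "\<dots> = (\<integral>\<^sup>+y. h y * ennreal (q y) \<partial>lborel)"
    by (simp add: distr_T Q.Q_def nn_integral_density mult.commute)
  finally show ?thesis .
qed

text \<open>The quotient \<open>p x / q (T x)\<close> stands for the derivative of \<open>T\<close>.
  With \<open>U (T x) = u x\<close>, push-forward turns its integral against \<open>u\<close> into
  the integral of \<open>U\<close> over the points where \<open>q\<close> is positive. Fubini turns
  the integral of \<open>U\<close> over all of \<open>{-r..r}\<close> into the right side, since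
  \<open>{y\<in>{-r..r}. F y < R z}\<close> has length \<open>T z + r\<close>. The share of
  \<open>U\<close> on the remaining points, the singular part of the derivative of \<open>T\<close>,
  accounts for the inequality.\<close>

lemma transport_by_parts:
  fixes u v :: "real \<Rightarrow> real"
  assumes u_nonneg: "\<And>x. 0 \<le> u x"
    and u_deriv: "\<And>x. (u has_real_derivative v x) (at x)"
    and v_cont: "continuous_on UNIV v"
    and supp: "\<And>x. B < \<bar>x\<bar> \<Longrightarrow> u x = 0" "\<And>x. B < \<bar>x\<bar> \<Longrightarrow> v x = 0"
  shows "0 \<le> - (\<integral>x. v x * T x \<partial>lborel)"
    and "(\<integral>\<^sup>+x. ennreal (u x * (p x / q (T x))) \<partial>lborel) \<le> ennreal (- (\<integral>x. v x * T x \<partial>lborel))"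
proof -
  have [measurable]: "u \<in> borel_measurable borel" "v \<in> borel_measurable borel"
    using u_deriv v_cont
    by (auto intro!: borel_measurable_continuous_onI continuous_at_imp_continuous_on intro: DERIV_isCont)
  obtain C where C: "\<And>x. \<bar>v x\<bar> \<le> C" "0 \<le> C"
  proof -
    have "compact (v ` {-B..B})"
      by (rule compact_continuous_image) (auto intro: continuous_on_subset[OF v_cont])
    then obtain C where C: "\<And>x. x \<in> {-B..B} \<Longrightarrow> \<bar>v x\<bar> \<le> C"
      by (fastforce dest!: compact_imp_bounded simp: bounded_iff)
    have "\<bar>v x\<bar> \<le> max C 0" for x
      using C[of x] supp(2)[of x] by (cases "x \<in> {-B..B}") (auto simp: abs_le_iff intro: max.coboundedI1)
    then show thesis using that by (meson max.cobounded2)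
  qed
  have v_le: "\<bar>v x\<bar> \<le> C * indicator {-B..B} x" for x
    using C(1)[of x] C(2) supp(2)[of x] by (cases "x \<in> {-B..B}") (auto simp: not_le)
  have ind_int: "integrable lborel (indicator {c..d} :: real \<Rightarrow> real)" for c d :: real
    by (cases "c \<le> d") (auto intro!: integrable_real_indicator)
  have v_int: "integrable lborel v"
    by (rule Bochner_Integration.integrable_bound[where f="\<lambda>x. C * indicator {-B..B} x"])
       (use v_le C(2) in \<open>auto intro!: integrable_mult_right ind_int simp: abs_mult\<close>)
  note ftc = integral_deriv_compact_support(1)[OF u_deriv v_cont supp]
    and ftc0 = integral_deriv_compact_support(2)[OF u_deriv v_cont supp]
  \<comment> \<open>\<open>U\<close> is \<open>u\<close> composed with the inverse of \<open>T\<close>, written so that no inverse is needed.\<close>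
  define U where "U y = (\<integral>z. - (if F y < R z then v z else 0) \<partial>lborel)" for y
  have U_T: "U (T x) = u x" for x
  proof -
    have "U (T x) = - (\<integral>z. indicator {x<..} z * v z \<partial>lborel)"
      unfolding U_def F_T P.dens_cdf_less_iff
      by (subst Bochner_Integration.integral_minus[symmetric])
        (rule Bochner_Integration.integral_cong, auto simp: indicator_def)
    then show ?thesis by (simp add: ftc)
  qed
  \<comment> \<open>\<open>U y\<close> depends on \<open>y\<close> only through \<open>F y\<close>.
    At the value 0 the whole integral of \<open>v\<close> appears, at 1 nothing does, and any value
    in between is attained by \<open>R\<close>, which leads back to \<open>u\<close>.\<close>
  have U_nonneg: "0 \<le> U y" for y
  proof -
    consider "F y = 0" | "F y = 1" | "0 < F y" "F y < 1"
      using Q.dens_cdf_nonneg[of y] Q.dens_cdf_le1[of y] by linarith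
    then show ?thesis
    proof cases
      case 1 then show ?thesis by (simp add: U_def P.dens_cdf_gt_0 ftc0)
    next
      case 2 then show ?thesis using P.dens_cdf_le1 by (simp add: U_def flip: not_less)
    next
      case 3
      then obtain x where "R x = F y" by (rule P.dens_cdf_attained)
      then have "U y = U (T x)" by (simp add: U_def F_T)
      then show ?thesis using U_T u_nonneg by simp
    qed
  qed
  let ?k = "\<lambda>(y, z). indicator {-r..r} y * (- (if F y < R z then v z else 0))"
  have k_meas[measurable]: "?k \<in> borel_measurable (lborel \<Otimes>\<^sub>M lborel)" by measurable
  have k_int: "integrable (lborel \<Otimes>\<^sub>M lborel) ?k"
  proof (rule Bochner_Integration.integrable_bound)
    show "integrable (lborel \<Otimes>\<^sub>M lborel) (\<lambda>(y::real, z::real). indicator {-r..r} y * (C * indicator {-B..B} z))"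
      by (intro lborel_pair.Fubini_integrable) (auto simp: abs_mult intro!: integrable_mult_right integrable_mult_left ind_int)
    show "AE x in lborel \<Otimes>\<^sub>M lborel. norm (?k x) \<le> norm ((\<lambda>(y::real, z::real). indicator {-r..r} y * (C * indicator {-B..B} z)) x)"
      using v_le C(2) by (auto simp: abs_mult indicator_def intro!: AE_I2 split: if_splits)
  qed (rule k_meas)
  have U_meas[measurable]: "U \<in> borel_measurable borel"
    unfolding U_def by measurable
  have "(\<integral>y. indicator {-r..r} y * U y \<partial>lborel) = (\<integral>y. (\<integral>z. ?k (y, z) \<partial>lborel) \<partial>lborel)"
    by (rule Bochner_Integration.integral_cong) (auto simp: U_def)
  also have "\<dots> = (\<integral>z. (\<integral>y. ?k (y, z) \<partial>lborel) \<partial>lborel)"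
    by (subst lborel_pair.Fubini_integral[symmetric]) (use k_int in auto)
  also have "\<dots> = (\<integral>z. - v z * (T z + r) \<partial>lborel)"
  proof (rule Bochner_Integration.integral_cong)
    fix z
    have "(\<integral>y. ?k (y, z) \<partial>lborel) = (\<integral>y. - v z * indicator {y\<in>{-r..r}. F y < R z} y \<partial>lborel)"
      by (rule Bochner_Integration.integral_cong) (auto simp: indicator_def)
    also have "\<dots> = - v z * (T z + r)"
      unfolding mono_transport_props(1) using mono_transport_props(2)[of z] by simp
    finally show "(\<integral>y. ?k (y, z) \<partial>lborel) = - v z * (T z + r)" .
  qed simp
  also have "\<dots> = - (\<integral>z. v z * T z \<partial>lborel)"
  proof -
    have "integrable lborel (\<lambda>z. v z * T z)"
      by (rule Bochner_Integration.integrable_bound[where f="\<lambda>z. r * v z"])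
        (use T_abs v_int r_nonneg in \<open>auto simp: abs_mult mult.commute[of r] intro!: AE_I2 mult_left_mono\<close>)
    \<comment> \<open>The shift by \<open>r\<close> costs nothing, as \<open>v\<close> has integral
      0.\<close>
    then show ?thesis
      using v_int ftc0 by (simp add: algebra_simps)
  qed
  finally have main: "(\<integral>y. indicator {-r..r} y * U y \<partial>lborel) = - (\<integral>z. v z * T z \<partial>lborel)" .
  have Ui: "integrable lborel (\<lambda>y. indicator {-r..r} y * U y)"
    using lborel_pair.integrable_fst[OF k_int] by (simp add: U_def)
  show "0 \<le> - (\<integral>x. v x * T x \<partial>lborel)"
    unfolding main[symmetric] using U_nonneg by (intro Bochner_Integration.integral_nonneg) auto
  have "(\<integral>\<^sup>+x. ennreal (u x * (p x / q (T x))) \<partial>lborel)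
      = (\<integral>\<^sup>+x. ennreal (U (T x) / q (T x)) * ennreal (p x) \<partial>lborel)"
    using P.p_pos by (intro nn_integral_cong) (simp add: U_T ennreal_mult''[symmetric] less_imp_le)
  also have "\<dots> = (\<integral>\<^sup>+y. ennreal (U y / q y) * ennreal (q y) \<partial>lborel)"
    by (rule nn_integral_T[where h="\<lambda>y. ennreal (U y / q y)"]) measurable
  also have "\<dots> \<le> (\<integral>\<^sup>+y. ennreal (indicator {-r..r} y * U y) \<partial>lborel)"
  proof (rule nn_integral_mono)
    fix y
    show "ennreal (U y / q y) * ennreal (q y) \<le> ennreal (indicator {-r..r} y * U y)"
    proof (cases "0 < q y")
      case True
      then have "y \<in> {-r..r}" using q_supp[of y] by (cases "r < \<bar>y\<bar>") auto
      then show ?thesis using True by (simp add: ennreal_mult''[symmetric])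
    qed (simp add: ennreal_neg)
  qed
  also have "\<dots> = ennreal (\<integral>y. indicator {-r..r} y * U y \<partial>lborel)"
    using Ui U_nonneg by (intro nn_integral_eq_integral) auto
  finally show "(\<integral>\<^sup>+x. ennreal (u x * (p x / q (T x))) \<partial>lborel) \<le> ennreal (- (\<integral>x. v x * T x \<partial>lborel))"
    by (simp add: main)
qed

end

section \<open>The Knothe map\<close>

text \<open>This holds for arbitrary \<open>p\<close> and \<open>q\<close>, because only a subset of
  \<open>{-r..r}\<close> is measured. Thus the Knothe map is bounded everywhere, also over the null
  set of base points where the conditional densities degenerate.\<close>

lemma mono_transport_bound:
  assumes "0 \<le> r" shows "\<bar>mono_transport p q r s\<bar> \<le> r"
proof -
  let ?A = "{y\<in>{-r..r}. dens_cdf q y < dens_cdf p s}"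
  have "emeasure lborel ?A \<le> emeasure lborel {-r..r}"
    by (rule emeasure_mono) auto
  also have "\<dots> = ennreal (2 * r)" using assms by simp
  finally have "measure lborel ?A \<le> 2 * r"
    unfolding measure_def using assms by (metis enn2real_leI mult_nonneg_nonneg zero_le_numeral)
  moreover have "0 \<le> measure lborel ?A" by simp
  ultimately show ?thesis unfolding mono_transport_def by linarith
qed

section \<open>Product measures, directional test functions and marginals\<close>

abbreviation PM :: "'i set \<Rightarrow> ('i \<Rightarrow> real) measure" where
  "PM I \<equiv> Pi\<^sub>M I (\<lambda>_. lborel)"

interpretation PMs: product_sigma_finite "\<lambda>_. lborel :: real measure"
  by standard

lemma sigma_finite_PM: "finite I \<Longrightarrow> sigma_finite_measure (PM I)"
  by (rule PMs.sigma_finite)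

lemma space_PM: "space (PM I) = extensional I"
  by (simp add: space_PiM PiE_def)

lemma fun_upd_space_PM: "x \<in> space (PM I) \<Longrightarrow> x(n := s) \<in> space (PM (insert n I))"
  by (auto simp: space_PM extensional_def)

text \<open>Iterated integrals suffice for nonnegative functions; statements about null sets and
  Bochner integrals are carried to the pair measure through this form.\<close>

lemma PM_insert:
  assumes "finite I" "n \<notin> I"
  shows "PM (insert n I) = distr (PM I \<Otimes>\<^sub>M lborel) (PM (insert n I)) (\<lambda>(x, s). x(n := s))"
proof (rule measure_eqI)
  fix X assume X[measurable]: "X \<in> sets (PM (insert n I))"
  have "emeasure (PM (insert n I)) X = (\<integral>\<^sup>+x. (\<integral>\<^sup>+s. indicator X (x(n := s)) \<partial>lborel) \<partial>PM I)"
    using assms by (subst PMs.product_nn_integral_insert[symmetric]) auto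
  also have "\<dots> = (\<integral>\<^sup>+z. indicator X ((\<lambda>(x, s). x(n := s)) z) \<partial>(PM I \<Otimes>\<^sub>M lborel))"
    by (subst lborel.nn_integral_fst[symmetric]) (auto simp: split_beta)
  also have "\<dots> = emeasure (distr (PM I \<Otimes>\<^sub>M lborel) (PM (insert n I)) (\<lambda>(x, s). x(n := s))) X"
    by (subst nn_integral_distr[symmetric, of _ _ "PM (insert n I)"]) auto
  finally show "emeasure (PM (insert n I)) X
      = emeasure (distr (PM I \<Otimes>\<^sub>M lborel) (PM (insert n I)) (\<lambda>(x, s). x(n := s))) X" .
qed simp

definition prob_dens :: "'i set \<Rightarrow> (('i \<Rightarrow> real) \<Rightarrow> real) \<Rightarrow> bool" where
  "prob_dens I f \<longleftrightarrow> f \<in> borel_measurable (PM I) \<and> (\<forall>x\<in>space (PM I). 0 \<le> f x) \<and> (\<integral>\<^sup>+x. ennreal (f x) \<partial>PM I) = 1"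

text \<open>Only the derivative in direction \<open>i\<close> is recorded, and continuity is asked
  for only along lines in that direction. Such a pair stays admissible when another coordinate is
  frozen, which the induction over the coordinates relies on.\<close>

definition directional_test ::
    "'i set \<Rightarrow> 'i \<Rightarrow> (('i \<Rightarrow> real) \<Rightarrow> real) \<Rightarrow> (('i \<Rightarrow> real) \<Rightarrow> real) \<Rightarrow> bool" where
  "directional_test I i u v \<longleftrightarrow>
    u \<in> borel_measurable (PM I) \<and> v \<in> borel_measurable (PM I) \<and>
    (\<forall>x\<in>space (PM I). 0 \<le> u x) \<and>
    (\<exists>B C. \<forall>x\<in>space (PM I). \<bar>v x\<bar> \<le> C \<and> ((\<exists>j\<in>I. B < \<bar>x j\<bar>) \<longrightarrow> u x = 0 \<and> v x = 0)) \<and>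
    (\<forall>x\<in>space (PM I). \<forall>s. ((\<lambda>s. u (x(i := s))) has_real_derivative v (x(i := s))) (at s)) \<and>
    (\<forall>x\<in>space (PM I). continuous_on UNIV (\<lambda>s. v (x(i := s))))"

text \<open>
  \<open>t i\<close> is the derivative of the \<open>i\<close>-th component of \<open>T\<close> in direction \<open>i\<close>. The last clause says that it is
  bounded by the distributional derivative; the sign condition is stated because \<^const>\<open>ennreal\<close> sends
  negative numbers to \<open>0\<close>.
\<close>

definition knothe_map ::
    "'i set \<Rightarrow> (('i \<Rightarrow> real) \<Rightarrow> real) \<Rightarrow> (('i \<Rightarrow> real) \<Rightarrow> real) \<Rightarrow> real \<Rightarrow>
      (('i \<Rightarrow> real) \<Rightarrow> ('i \<Rightarrow> real)) \<Rightarrow> ('i \<Rightarrow> ('i \<Rightarrow> real) \<Rightarrow> real) \<Rightarrow> bool" where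
  "knothe_map I \<rho> f r T t \<longleftrightarrow>
    T \<in> PM I \<rightarrow>\<^sub>M PM I \<and>
    (\<forall>i\<in>I. t i \<in> borel_measurable (PM I) \<and> (\<forall>x\<in>space (PM I). 0 \<le> t i x \<and> \<bar>T x i\<bar> \<le> r)) \<and>
    (\<forall>h\<in>borel_measurable (PM I). (\<integral>\<^sup>+x. h (T x) * ennreal (\<rho> x) \<partial>PM I) = (\<integral>\<^sup>+y. h y * ennreal (f y) \<partial>PM I)) \<and>
    (AE x in PM I. (\<Prod>i\<in>I. t i x) = \<rho> x / f (T x)) \<and>
    (\<forall>i\<in>I. \<forall>u v. directional_test I i u v \<longrightarrow>
        0 \<le> - (\<integral>x. v x * T x i \<partial>PM I) \<and>
        (\<integral>\<^sup>+x. ennreal (u x * t i x) \<partial>PM I) \<le> ennreal (- (\<integral>x. v x * T x i \<partial>PM I)))"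

definition marg :: "'i \<Rightarrow> (('i \<Rightarrow> real) \<Rightarrow> real) \<Rightarrow> ('i \<Rightarrow> real) \<Rightarrow> real" where
  "marg n f x = enn2real (\<integral>\<^sup>+s. ennreal (f (x(n := s))) \<partial>lborel)"

text \<open>
  The marginal can be infinite on a null set, where \<^const>\<open>marg\<close> is \<open>0\<close>; the source density has to stay
  positive everywhere.
\<close>

definition pmarg :: "'i \<Rightarrow> (('i \<Rightarrow> real) \<Rightarrow> real) \<Rightarrow> ('i \<Rightarrow> real) \<Rightarrow> real" where
  "pmarg n f x = (if (\<integral>\<^sup>+s. ennreal (f (x(n := s))) \<partial>lborel) = \<infinity> then 1 else marg n f x)"

lemma slice_measurable:
  assumes "f \<in> PM (insert n I) \<rightarrow>\<^sub>M N"
  shows "(\<lambda>(x, s). f (x(n := s))) \<in> PM I \<Otimes>\<^sub>M lborel \<rightarrow>\<^sub>M N"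
  using measurable_comp[OF measurable_add_dim assms] by (simp add: comp_def split_beta)

lemma slice_measurable1:
  assumes "f \<in> PM (insert n I) \<rightarrow>\<^sub>M N" "n \<notin> I" "x \<in> space (PM I)"
  shows "(\<lambda>s. f (x(n := s))) \<in> borel \<rightarrow>\<^sub>M N"
  using measurable_comp[OF measurable_component_update[OF assms(3,2)] assms(1)]
  by (simp add: comp_def)

lemma slice_measurable2:
  assumes "f \<in> PM (insert n I) \<rightarrow>\<^sub>M N"
  shows "(\<lambda>x. f (x(n := s))) \<in> PM I \<rightarrow>\<^sub>M N"
proof -
  have "(\<lambda>x. x(n := s)) \<in> PM I \<rightarrow>\<^sub>M PM (insert n I)"
    by (rule measurable_fun_upd[where J=I]) auto
  from measurable_comp[OF this assms] show ?thesis by (simp add: comp_def)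
qed

lemma marg_measurable:
  assumes "f \<in> borel_measurable (PM (insert n I))"
  shows "(\<lambda>x. \<integral>\<^sup>+s. ennreal (f (x(n := s))) \<partial>lborel) \<in> borel_measurable (PM I)"
    and "marg n f \<in> borel_measurable (PM I)" "pmarg n f \<in> borel_measurable (PM I)"
proof -
  note [measurable] = slice_measurable[OF assms]
  show [measurable]: "(\<lambda>x. \<integral>\<^sup>+s. ennreal (f (x(n := s))) \<partial>lborel) \<in> borel_measurable (PM I)"
    by measurable
  show [measurable]: "marg n f \<in> borel_measurable (PM I)"
    unfolding marg_def[abs_def] by measurable
  show "pmarg n f \<in> borel_measurable (PM I)"
    unfolding pmarg_def[abs_def] by measurable
qed

lemma
  assumes "prob_dens (insert n I) f" "finite I" "n \<notin> I"
  shows nn_integral_marg: "(\<integral>\<^sup>+x. (\<integral>\<^sup>+s. ennreal (f (x(n := s))) \<partial>lborel) \<partial>PM I) = 1"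
    and AE_marg_finite: "AE x in PM I. (\<integral>\<^sup>+s. ennreal (f (x(n := s))) \<partial>lborel) < \<infinity>"
    and prob_dens_marg: "prob_dens I (marg n f)"
    and prob_dens_pmarg: "prob_dens I (pmarg n f)"
proof -
  have m: "f \<in> borel_measurable (PM (insert n I))" using assms by (simp add: prob_dens_def)
  show *: "(\<integral>\<^sup>+x. (\<integral>\<^sup>+s. ennreal (f (x(n := s))) \<partial>lborel) \<partial>PM I) = 1"
    using assms m by (subst PMs.product_nn_integral_insert[symmetric]) (auto simp: prob_dens_def)
  show AE: "AE x in PM I. (\<integral>\<^sup>+s. ennreal (f (x(n := s))) \<partial>lborel) < \<infinity>"
    using nn_integral_PInf_AE[OF marg_measurable(1)[OF m]] * by (auto simp: less_top)
  have "(\<integral>\<^sup>+x. ennreal (marg n f x) \<partial>PM I) = 1"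
    unfolding *[symmetric]
    by (rule nn_integral_cong_AE) (use AE in eventually_elim, auto simp: marg_def)
  then show "prob_dens I (marg n f)"
    using marg_measurable[OF m] by (simp add: prob_dens_def marg_def)
  have "(\<integral>\<^sup>+x. ennreal (pmarg n f x) \<partial>PM I) = 1"
    unfolding *[symmetric]
    by (rule nn_integral_cong_AE) (use AE in eventually_elim, auto simp: pmarg_def marg_def)
  then show "prob_dens I (pmarg n f)"
    using marg_measurable[OF m] by (simp add: prob_dens_def pmarg_def marg_def)
qed

lemma pmarg_pos:
  assumes "f \<in> borel_measurable (PM (insert n I))" "n \<notin> I" "x \<in> space (PM I)"
    and pos: "\<And>x. x \<in> space (PM (insert n I)) \<Longrightarrow> 0 < f x"
  shows "0 < pmarg n f x"
proof -
  note [measurable] = slice_measurable1[OF assms(1-3)]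
  have "(\<integral>\<^sup>+s. ennreal (f (x(n := s))) \<partial>lborel) \<noteq> 0"
  proof
    assume "(\<integral>\<^sup>+s. ennreal (f (x(n := s))) \<partial>lborel) = 0"
    then have "AE s in lborel. ennreal (f (x(n := s))) = 0"
      by (subst (asm) nn_integral_0_iff_AE) auto
    then have "AE s::real in lborel. False"
      by eventually_elim (use pos fun_upd_space_PM[OF assms(3)] in \<open>force simp: ennreal_eq_0_iff not_le[symmetric]\<close>)
    then show False using AE_iff_measurable[of "UNIV::real set" lborel "\<lambda>_. False"] by simp
  qed
  then show ?thesis
    by (auto simp: pmarg_def marg_def enn2real_positive_iff less_top zero_less_iff_neq_zero)
qed

lemma directional_test_integrable:
  assumes "directional_test I i u v" "finite I"
    and [measurable]: "w \<in> borel_measurable (PM I)" and w: "\<And>x. x \<in> space (PM I) \<Longrightarrow> \<bar>w x\<bar> \<le> r"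
  shows "integrable (PM I) (\<lambda>x. v x * w x)"
proof -
  obtain B C where BC: "\<And>x. x \<in> space (PM I) \<Longrightarrow> \<bar>v x\<bar> \<le> C"
      "\<And>x. x \<in> space (PM I) \<Longrightarrow> \<exists>j\<in>I. B < \<bar>x j\<bar> \<Longrightarrow> v x = 0"
    and [measurable]: "v \<in> borel_measurable (PM I)"
    using assms(1) unfolding directional_test_def by metis
  let ?A = "Pi\<^sub>E I (\<lambda>_. {-B..B})"
  show ?thesis
  proof (rule integrableI_bounded_set)
    show "?A \<in> sets (PM I)" using assms(2) by (intro sets_PiM_I_finite) auto
    have "emeasure (PM I) ?A = (\<Prod>i\<in>I. emeasure lborel {-B..B})"
      using assms(2) by (subst PMs.emeasure_PiM) auto
    also have "\<dots> < \<infinity>"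
      by (cases "-B \<le> B") (auto simp: less_top[symmetric] ennreal_prod_eq_top power_eq_top_ennreal)
    finally show "emeasure (PM I) ?A < \<infinity>" .
    show "AE x in PM I. x \<in> ?A \<longrightarrow> norm (v x * w x) \<le> C * r"
    proof (intro AE_I2 impI)
      fix x assume x: "x \<in> space (PM I)"
      then show "norm (v x * w x) \<le> C * r"
        using BC(1)[OF x] w[OF x] abs_ge_zero[of "v x"] by (auto simp: abs_mult intro!: mult_mono)
    qed
    show "AE x in PM I. x \<notin> ?A \<longrightarrow> v x * w x = 0"
    proof (intro AE_I2 impI)
      fix x assume x: "x \<in> space (PM I)" "x \<notin> ?A"
      then have "\<exists>j\<in>I. B < \<bar>x j\<bar>" by (force simp: space_PM PiE_def)
      then show "v x * w x = 0" using BC(2)[OF x(1)] by simp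
    qed
  qed measurable
qed

section \<open>Adding one coordinate to the Knothe map\<close>

locale knothe_step =
  fixes I :: "'i set" and n :: 'i and \<rho> f :: "('i \<Rightarrow> real) \<Rightarrow> real" and r :: real and T' t'
  assumes fin: "finite I" and nI: "n \<notin> I"
    and \<rho>: "prob_dens (insert n I) \<rho>" and \<rho>_pos: "\<And>x. x \<in> space (PM (insert n I)) \<Longrightarrow> 0 < \<rho> x"
    and f: "prob_dens (insert n I) f"
    and f_supp: "\<And>x. x \<in> space (PM (insert n I)) \<Longrightarrow> \<exists>j\<in>insert n I. r < \<bar>x j\<bar> \<Longrightarrow> f x = 0"
    and r: "0 \<le> r"
    and IH: "knothe_map I (pmarg n \<rho>) (marg n f) r T' t'"
begin

abbreviation "J \<equiv> insert n I"
abbreviation "G x \<equiv> (\<integral>\<^sup>+s. ennreal (\<rho> (x(n := s))) \<partial>lborel)"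
abbreviation "Gf x \<equiv> (\<integral>\<^sup>+s. ennreal (f (x(n := s))) \<partial>lborel)"
abbreviation "\<rho>' \<equiv> pmarg n \<rho>"
abbreviation "f' \<equiv> marg n f"
definition "p x s = \<rho> (x(n := s)) / \<rho>' x"
definition "q y s = f (y(n := s)) / f' y"
text \<open>Over each base point \<open>x\<close> the conditional density of \<open>\<rho>\<close>
  is sent to that of \<open>f\<close> over \<open>T' x\<close>. The resulting map is triangular: its
  components in \<open>I\<close> ignore the coordinate \<open>n\<close>, so the product of the
  \<open>t i\<close> plays the part of a Jacobian determinant.\<close>

definition "S x s = mono_transport (p x) (q (T' x)) r s"
definition "T z = (T' (restrict z I))(n := S (restrict z I) (z n))"
definition "t i z = (if i = n then p (restrict z I) (z n) / q (T' (restrict z I)) (S (restrict z I) (z n))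
   else t' i (restrict z I))"
text \<open>These are the base points over which both conditional densities have mass one. Elsewhere
  \<open>p x\<close> has infinite mass or \<open>q (T' x)\<close>, a division by zero, vanishes
  identically.\<close>

definition "good x \<longleftrightarrow> G x < \<infinity> \<and> 0 < f' (T' x)"

lemma T'_meas[measurable]: "T' \<in> PM I \<rightarrow>\<^sub>M PM I"
  and t'_meas: "i \<in> I \<Longrightarrow> t' i \<in> borel_measurable (PM I)"
  and t'_nonneg: "i \<in> I \<Longrightarrow> x \<in> space (PM I) \<Longrightarrow> 0 \<le> t' i x"
  and T'_bound: "i \<in> I \<Longrightarrow> x \<in> space (PM I) \<Longrightarrow> \<bar>T' x i\<bar> \<le> r"
  and T'_push: "h \<in> borel_measurable (PM I) \<Longrightarrow>
      (\<integral>\<^sup>+x. h (T' x) * ennreal (\<rho>' x) \<partial>PM I) = (\<integral>\<^sup>+y. h y * ennreal (f' y) \<partial>PM I)"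
  and t'_prod: "AE x in PM I. (\<Prod>i\<in>I. t' i x) = \<rho>' x / f' (T' x)"
  and T'_test: "i \<in> I \<Longrightarrow> directional_test I i u v \<Longrightarrow> 0 \<le> - (\<integral>x. v x * T' x i \<partial>PM I)"
    "i \<in> I \<Longrightarrow> directional_test I i u v \<Longrightarrow>
        (\<integral>\<^sup>+x. ennreal (u x * t' i x) \<partial>PM I) \<le> ennreal (- (\<integral>x. v x * T' x i \<partial>PM I))"
  using IH unfolding knothe_map_def by blast+

lemma \<rho>_meas[measurable]: "\<rho> \<in> borel_measurable (PM J)"
  and f_meas[measurable]: "f \<in> borel_measurable (PM J)"
  and f_nonneg: "x \<in> space (PM J) \<Longrightarrow> 0 \<le> f x"
  using \<rho> f by (auto simp: prob_dens_def)

lemma T'_space: "x \<in> space (PM I) \<Longrightarrow> T' x \<in> space (PM I)"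
  by (rule measurable_space[OF T'_meas])

lemmas [measurable] = marg_measurable[OF \<rho>_meas] marg_measurable[OF f_meas]

lemma \<rho>'_pos: "x \<in> space (PM I) \<Longrightarrow> 0 < \<rho>' x"
  by (rule pmarg_pos[OF \<rho>_meas nI _ \<rho>_pos])

text \<open>The points where \<open>f'\<close> vanishes carry no target mass, so by push-forward
  their preimage under \<open>T'\<close> has no source mass. As \<open>\<rho>'\<close> is positive
  everywhere, that preimage is a Lebesgue null set.\<close>

lemma AE_good: "AE x in PM I. good x"
proof -
  let ?h = "\<lambda>y. if f' y \<le> 0 then 1 else (0::ennreal)"
  have "(\<integral>\<^sup>+x. ?h (T' x) * ennreal (\<rho>' x) \<partial>PM I) = (\<integral>\<^sup>+y. ?h y * ennreal (f' y) \<partial>PM I)"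
    by (rule T'_push) measurable
  also have "\<dots> = (\<integral>\<^sup>+(y::'i\<Rightarrow>real). 0 \<partial>PM I)"
    by (rule nn_integral_cong) (auto simp: ennreal_neg)
  finally have "(\<integral>\<^sup>+x. ?h (T' x) * ennreal (\<rho>' x) \<partial>PM I) = 0" by simp
  then have "AE x in PM I. ?h (T' x) * ennreal (\<rho>' x) = 0"
    by (subst (asm) nn_integral_0_iff_AE) measurable
  with AE_space AE_marg_finite[OF \<rho> fin nI] show ?thesis
  proof eventually_elim
    case (elim x)
    then show ?case using \<rho>'_pos[of x] by (auto simp: good_def split: if_splits)
  qed
qed

lemma slice_pair:
  assumes x: "x \<in> space (PM I)" and g: "good x"
  shows "transport_pair (p x) (q (T' x)) r"
proof unfold_locales
  note [measurable] = slice_measurable1[OF \<rho>_meas nI x] slice_measurable1[OF f_meas nI T'_space[OF x]]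
  show "p x \<in> borel_measurable borel" unfolding p_def[abs_def] by measurable
  show "q (T' x) \<in> borel_measurable borel" unfolding q_def[abs_def] by measurable
  have Gx: "G x = ennreal (\<rho>' x)" using g by (auto simp: good_def pmarg_def marg_def less_top)
  have "(\<integral>\<^sup>+s. ennreal (p x s) \<partial>lborel) = (\<integral>\<^sup>+s. ennreal (\<rho> (x(n := s))) / ennreal (\<rho>' x) \<partial>lborel)"
    using \<rho>'_pos[OF x] \<rho>_pos[OF fun_upd_space_PM[OF x]]
    by (intro nn_integral_cong) (simp add: p_def divide_ennreal less_imp_le)
  also have "\<dots> = G x / ennreal (\<rho>' x)" by (rule nn_integral_divide) measurable
  also have "\<dots> = 1" unfolding Gx using \<rho>'_pos[OF x] by (simp add: ennreal_divide_self)
  finally show "(\<integral>\<^sup>+s. ennreal (p x s) \<partial>lborel) = 1" .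
  have f'pos: "0 < f' (T' x)" using g by (simp add: good_def)
  then have Gfx: "Gf (T' x) = ennreal (f' (T' x))"
    by (cases "Gf (T' x)") (auto simp: marg_def)
  have "(\<integral>\<^sup>+s. ennreal (q (T' x) s) \<partial>lborel) = (\<integral>\<^sup>+s. ennreal (f ((T' x)(n := s))) / ennreal (f' (T' x)) \<partial>lborel)"
    using f'pos f_nonneg[OF fun_upd_space_PM[OF T'_space[OF x]]]
    by (intro nn_integral_cong) (simp add: q_def divide_ennreal)
  also have "\<dots> = Gf (T' x) / ennreal (f' (T' x))" by (rule nn_integral_divide) measurable
  also have "\<dots> = 1" unfolding Gfx using f'pos by (simp add: ennreal_divide_self)
  finally show "(\<integral>\<^sup>+s. ennreal (q (T' x) s) \<partial>lborel) = 1" .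
  show "0 < p x s" for s
    using \<rho>'_pos[OF x] \<rho>_pos[OF fun_upd_space_PM[OF x]] by (simp add: p_def)
  show "q (T' x) s = 0" if "r < \<bar>s\<bar>" for s
    using f_supp[OF fun_upd_space_PM[OF T'_space[OF x]], of s] that by (simp add: q_def)
qed

lemma p_meas[measurable]: "(\<lambda>(x, s). p x s) \<in> borel_measurable (PM I \<Otimes>\<^sub>M lborel)"
proof -
  note [measurable] = slice_measurable[OF \<rho>_meas]
  show ?thesis unfolding p_def by measurable
qed

lemma q_meas[measurable]: "(\<lambda>(x, s). q x s) \<in> borel_measurable (PM I \<Otimes>\<^sub>M lborel)"
proof -
  note [measurable] = slice_measurable[OF f_meas]
  show ?thesis unfolding q_def by measurable
qed

lemma dens_cdf_param_measurable:
  assumes [measurable]: "(\<lambda>(x, s). k x s) \<in> borel_measurable (PM I \<Otimes>\<^sub>M lborel)"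
  shows "(\<lambda>(x, s). dens_cdf (k x) s) \<in> borel_measurable (PM I \<Otimes>\<^sub>M lborel)"
proof -
  \<comment> \<open>With the bound \<open>s\<close> moved from an indicator into a condition, the
    integrand is visibly measurable in \<open>x\<close>, \<open>s\<close> and \<open>z\<close>
    jointly.\<close>
  have "dens_cdf (k x) s = enn2real (\<integral>\<^sup>+z. (if z \<le> s then ennreal (k x z) else 0) \<partial>lborel)" for x s
    unfolding dens_cdf_def by (intro arg_cong[where f=enn2real] nn_integral_cong) (auto simp: indicator_def)
  then show ?thesis by simp
qed

lemma S_meas[measurable]: "(\<lambda>(x, s). S x s) \<in> borel_measurable (PM I \<Otimes>\<^sub>M lborel)"
proof -
  have [measurable]: "(\<lambda>(x, s). dens_cdf (p x) s) \<in> borel_measurable (PM I \<Otimes>\<^sub>M lborel)"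
    by (rule dens_cdf_param_measurable) measurable
  have [measurable]: "(\<lambda>(x, s). dens_cdf (q (T' x)) s) \<in> borel_measurable (PM I \<Otimes>\<^sub>M lborel)"
    by (rule dens_cdf_param_measurable) measurable
  have "(\<lambda>z. measure lborel {y \<in> space lborel. -r \<le> y \<and> y \<le> r \<and> dens_cdf (q (T' (fst z))) y < dens_cdf (p (fst z)) (snd z)})
     \<in> borel_measurable (PM I \<Otimes>\<^sub>M lborel)"
    unfolding measure_def by measurable
  then show ?thesis
    unfolding S_def mono_transport_def by (simp add: split_beta conj_assoc)
qed

lemma restrict_upd: "x \<in> space (PM I) \<Longrightarrow> restrict (x(n := s)) I = x"
  using nI by (auto simp: space_PM extensional_def restrict_def fun_eq_iff)

lemma T_upd: "x \<in> space (PM I) \<Longrightarrow> T (x(n := s)) = (T' x)(n := S x s)"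
  by (simp add: T_def restrict_upd)

lemma t_upd_n: "x \<in> space (PM I) \<Longrightarrow> t n (x(n := s)) = p x s / q (T' x) (S x s)"
  by (simp add: t_def restrict_upd)

lemma t_upd: "x \<in> space (PM I) \<Longrightarrow> i \<in> I \<Longrightarrow> t i (x(n := s)) = t' i x"
  using nI by (auto simp: t_def restrict_upd[of x s, simplified] space_PM extensional_restrict)

lemma restrict_meas[measurable]: "(\<lambda>z. restrict z I) \<in> PM J \<rightarrow>\<^sub>M PM I"
  by (rule measurable_restrict_subset) auto

lemma T_meas[measurable]: "T \<in> PM J \<rightarrow>\<^sub>M PM J"
  unfolding T_def[abs_def] by (rule measurable_fun_upd[where J=I]) auto

lemma t_meas: "i \<in> J \<Longrightarrow> t i \<in> borel_measurable (PM J)"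
proof (cases "i = n")
  case True then show ?thesis unfolding t_def[abs_def] by simp
next
  case False
  assume "i \<in> J"
  with False have [measurable]: "t' i \<in> borel_measurable (PM I)" using t'_meas by auto
  show ?thesis using False unfolding t_def[abs_def] by simp
qed

lemma nn_split:
  assumes "h \<in> borel_measurable (PM J)"
  shows "(\<integral>\<^sup>+z. h z \<partial>PM J) = (\<integral>\<^sup>+x. (\<integral>\<^sup>+s. h (x(n := s)) \<partial>lborel) \<partial>PM I)"
  using fin nI assms by (rule PMs.product_nn_integral_insert)

text \<open>Disintegration: \<open>\<rho>\<close> and \<open>f\<close> are \<open>p\<close> and
  \<open>q\<close> times their marginals. One-dimensional push-forward on almost every fibre
  produces \<open>H (T' x)\<close>, and \<open>T'\<close> then transports the base.\<close>

lemma T_push: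
  assumes h[measurable]: "h \<in> borel_measurable (PM J)"
  shows "(\<integral>\<^sup>+z. h (T z) * ennreal (\<rho> z) \<partial>PM J) = (\<integral>\<^sup>+y. h y * ennreal (f y) \<partial>PM J)"
proof -
  note [measurable] = slice_measurable[OF h]
  define H where "H y = (\<integral>\<^sup>+s. h (y(n := s)) * ennreal (q y s) \<partial>lborel)" for y
  have H_meas: "H \<in> borel_measurable (PM I)" unfolding H_def by measurable
  have "(\<integral>\<^sup>+z. h (T z) * ennreal (\<rho> z) \<partial>PM J)
      = (\<integral>\<^sup>+x. (\<integral>\<^sup>+s. h (T (x(n := s))) * ennreal (\<rho> (x(n := s))) \<partial>lborel) \<partial>PM I)"
    by (rule nn_split) measurable
  also have "\<dots> = (\<integral>\<^sup>+x. H (T' x) * ennreal (\<rho>' x) \<partial>PM I)"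
  proof (rule nn_integral_cong_AE)
    show "AE x in PM I. (\<integral>\<^sup>+s. h (T (x(n := s))) * ennreal (\<rho> (x(n := s))) \<partial>lborel) = H (T' x) * ennreal (\<rho>' x)"
      using AE_space AE_good
    proof eventually_elim
      case (elim x)
      interpret S: transport_pair "p x" "q (T' x)" r by (rule slice_pair) fact+
      note [measurable] = slice_measurable1[OF h nI T'_space[OF elim(1)]] slice_measurable1[OF \<rho>_meas nI elim(1)]
      have "(\<integral>\<^sup>+s. h (T (x(n := s))) * ennreal (\<rho> (x(n := s))) \<partial>lborel)
         = (\<integral>\<^sup>+s. h ((T' x)(n := mono_transport (p x) (q (T' x)) r s)) * ennreal (p x s) * ennreal (\<rho>' x) \<partial>lborel)"
        using \<rho>'_pos[OF elim(1)] S.P.p_pos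
        by (intro nn_integral_cong) (simp add: T_upd elim S_def mult.assoc ennreal_mult''[symmetric], simp add: p_def)
      also have "\<dots> = (\<integral>\<^sup>+s. h ((T' x)(n := mono_transport (p x) (q (T' x)) r s)) * ennreal (p x s) \<partial>lborel) * ennreal (\<rho>' x)"
        by (rule nn_integral_multc) measurable
      also have "\<dots> = H (T' x) * ennreal (\<rho>' x)"
        by (subst S.nn_integral_T) (auto simp: H_def)
      finally show ?case .
    qed
  qed
  also have "\<dots> = (\<integral>\<^sup>+y. H y * ennreal (f' y) \<partial>PM I)"
    by (rule T'_push[OF H_meas])
  also have "\<dots> = (\<integral>\<^sup>+y. (\<integral>\<^sup>+s. h (y(n := s)) * ennreal (f (y(n := s))) \<partial>lborel) \<partial>PM I)"
  proof (rule nn_integral_cong_AE)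
    show "AE y in PM I. H y * ennreal (f' y) = (\<integral>\<^sup>+s. h (y(n := s)) * ennreal (f (y(n := s))) \<partial>lborel)"
      using AE_space AE_marg_finite[OF f fin nI]
    proof eventually_elim
      case (elim y)
      note [measurable] = slice_measurable1[OF h nI elim(1)] slice_measurable1[OF f_meas nI elim(1)]
      have fn: "0 \<le> f (y(n := s))" for s using f_nonneg fun_upd_space_PM[OF elim(1)] by auto
      have [measurable]: "q y \<in> borel_measurable borel" unfolding q_def[abs_def] by measurable
      have Gf: "Gf y = ennreal (f' y)" using elim(2) by (simp add: marg_def)
      have f'n: "0 \<le> f' y" by (simp add: marg_def)
      show ?case
      proof (cases "f' y = 0")
        \<comment> \<open>Here \<open>q y\<close> is a division by zero, so \<open>f\<close> cannot
          be recovered from it; but a zero marginal makes \<open>f\<close> vanish almost everywhere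
          on the fibre.\<close>
        case True
        then have "AE s in lborel. ennreal (f (y(n := s))) = 0"
          using Gf by (subst nn_integral_0_iff_AE[symmetric]) auto
        then have "(\<integral>\<^sup>+s. h (y(n := s)) * ennreal (f (y(n := s))) \<partial>lborel) = (\<integral>\<^sup>+(s::real). 0 \<partial>lborel)"
          by (intro nn_integral_cong_AE) auto
        then show ?thesis using True by simp
      next
        case False
        then have "0 < f' y" using f'n by simp
        have "H y * ennreal (f' y) = (\<integral>\<^sup>+s. h (y(n := s)) * ennreal (q y s) * ennreal (f' y) \<partial>lborel)"
          unfolding H_def by (rule nn_integral_multc[symmetric]) measurable
        also have "\<dots> = (\<integral>\<^sup>+s. h (y(n := s)) * ennreal (f (y(n := s))) \<partial>lborel)"
          using \<open>0 < f' y\<close> fn by (intro nn_integral_cong) (simp add: q_def mult.assoc ennreal_mult''[symmetric])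
        finally show ?thesis .
      qed
    qed
  qed
  also have "\<dots> = (\<integral>\<^sup>+y. h y * ennreal (f y) \<partial>PM J)"
    by (rule nn_split[symmetric]) measurable
  finally show ?thesis .
qed

text \<open>Over almost every base point the new factor is the quotient of the conditional
  densities, the old factors multiply to the quotient of the marginals, and the marginals
  cancel.\<close>

lemma t_prod: "AE z in PM J. (\<Prod>i\<in>J. t i z) = \<rho> z / f (T z)"
proof -
  have [measurable]: "(\<lambda>z. \<Prod>i\<in>J. t i z) \<in> borel_measurable (PM J)"
    by (rule borel_measurable_prod) (rule t_meas)
  interpret A: sigma_finite_measure "PM I" by (rule sigma_finite_PM[OF fin])
  interpret P: pair_sigma_finite "PM I" lborel ..
  have "AE z in PM I \<Otimes>\<^sub>M lborel. (\<lambda>z. (\<Prod>i\<in>J. t i z) = \<rho> z / f (T z)) ((\<lambda>(x, s). x(n := s)) z)"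
  proof (rule P.AE_pair_measure)
    have "{z \<in> space (PM J). (\<Prod>i\<in>J. t i z) = \<rho> z / f (T z)} \<in> sets (PM J)" by measurable
    from measurable_sets[OF measurable_add_dim this]
    show "{z \<in> space (PM I \<Otimes>\<^sub>M lborel). (\<lambda>z. (\<Prod>i\<in>J. t i z) = \<rho> z / f (T z)) ((\<lambda>(x, s). x(n := s)) z)}
       \<in> sets (PM I \<Otimes>\<^sub>M lborel)"
      by (rule back_subst[where P="\<lambda>X. X \<in> _"]) (auto simp: space_pair_measure fun_upd_space_PM)
    show "AE x in PM I. AE s in lborel. (\<lambda>z. (\<Prod>i\<in>J. t i z) = \<rho> z / f (T z)) ((\<lambda>(x, s). x(n := s)) (x, s))"
      using AE_space AE_good t'_prod
    proof eventually_elim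
      case (elim x)
      have "(\<Prod>i\<in>J. t i (x(n := s))) = \<rho> (x(n := s)) / f (T (x(n := s)))" for s
      proof -
        have "(\<Prod>i\<in>J. t i (x(n := s))) = p x s / q (T' x) (S x s) * (\<rho>' x / f' (T' x))"
          using fin nI elim by (simp add: t_upd_n t_upd)
        also have "\<dots> = \<rho> (x(n := s)) / f (T (x(n := s)))"
          using \<rho>'_pos[OF elim(1)] elim by (simp add: p_def q_def T_upd good_def)
        finally show ?thesis .
      qed
      then show ?case by simp
    qed
  qed
  then show ?thesis
    by (subst PM_insert[OF fin nI], subst AE_distr_iff) (auto simp: split_beta)
qed

lemma directional_test_slice:
  assumes "directional_test J i u v" "i \<in> I"
  shows "directional_test I i (\<lambda>x. u (x(n := s))) (\<lambda>x. v (x(n := s)))"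
proof -
  obtain B C where BC: "\<And>x. x \<in> space (PM J) \<Longrightarrow> \<bar>v x\<bar> \<le> C"
      "\<And>x. x \<in> space (PM J) \<Longrightarrow> \<exists>j\<in>J. B < \<bar>x j\<bar> \<Longrightarrow> u x = 0 \<and> v x = 0"
    using assms(1) unfolding directional_test_def by metis
  have [simp]: "x(i := s', n := s) = x(n := s, i := s')" for x s'
    using assms(2) nI by (auto simp: fun_upd_twist)
  show ?thesis
    unfolding directional_test_def
  proof (intro conjI)
    show "(\<lambda>x. u (x(n := s))) \<in> borel_measurable (PM I)" "(\<lambda>x. v (x(n := s))) \<in> borel_measurable (PM I)"
      using assms(1) by (auto intro!: slice_measurable2 simp: directional_test_def)
    show "\<exists>B C. \<forall>x\<in>space (PM I). \<bar>v (x(n := s))\<bar> \<le> C \<and> ((\<exists>j\<in>I. B < \<bar>x j\<bar>) \<longrightarrow> u (x(n := s)) = 0 \<and> v (x(n := s)) = 0)"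
    proof (intro exI ballI conjI impI)
      fix x assume x: "x \<in> space (PM I)"
      show "\<bar>v (x(n := s))\<bar> \<le> C" by (rule BC(1)[OF fun_upd_space_PM[OF x]])
      assume "\<exists>j\<in>I. B < \<bar>x j\<bar>"
      then have "\<exists>j\<in>J. B < \<bar>(x(n := s)) j\<bar>" using nI by auto
      then show "u (x(n := s)) = 0" "v (x(n := s)) = 0" using BC(2)[OF fun_upd_space_PM[OF x]] by auto
    qed
  qed (use assms(1) fun_upd_space_PM[of _ I n s] in \<open>auto simp: directional_test_def\<close>)
qed

lemma T_bound: "i \<in> J \<Longrightarrow> x \<in> space (PM J) \<Longrightarrow> \<bar>T x i\<bar> \<le> r"
  using T'_bound[of i "restrict x I"] mono_transport_bound[OF r]
  by (auto simp: T_def S_def space_PM)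

lemma T_comp_meas: "i \<in> J \<Longrightarrow> (\<lambda>x. T x i) \<in> borel_measurable (PM J)"
  using measurable_comp[OF T_meas measurable_component_singleton[of i J "\<lambda>_. lborel"]] by (simp add: comp_def)

lemma T_test:
  assumes i: "i \<in> J" and uv: "directional_test J i u v"
  shows "0 \<le> - (\<integral>x. v x * T x i \<partial>PM J)"
    and "(\<integral>\<^sup>+x. ennreal (u x * t i x) \<partial>PM J) \<le> ennreal (- (\<integral>x. v x * T x i \<partial>PM J))"
proof -
  interpret A: sigma_finite_measure "PM I" by (rule sigma_finite_PM[OF fin])
  interpret P: pair_sigma_finite "PM I" lborel ..
  have [measurable]: "u \<in> borel_measurable (PM J)" "v \<in> borel_measurable (PM J)"
    "t i \<in> borel_measurable (PM J)" "(\<lambda>x. T x i) \<in> borel_measurable (PM J)"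
    using uv i t_meas T_comp_meas by (auto simp: directional_test_def)
  obtain B C where BC: "\<And>x. x \<in> space (PM J) \<Longrightarrow> 0 \<le> u x"
      "\<And>x. x \<in> space (PM J) \<Longrightarrow> \<exists>j\<in>J. B < \<bar>x j\<bar> \<Longrightarrow> u x = 0 \<and> v x = 0"
      "\<And>x s. x \<in> space (PM J) \<Longrightarrow> ((\<lambda>s. u (x(i := s))) has_real_derivative v (x(i := s))) (at s)"
      "\<And>x. x \<in> space (PM J) \<Longrightarrow> continuous_on UNIV (\<lambda>s. v (x(i := s)))"
    using uv unfolding directional_test_def by metis
  let ?k = "\<lambda>(x, s). - v (x(n := s)) * T (x(n := s)) i"
  have int: "integrable (PM J) (\<lambda>x. v x * T x i)"
    using uv fin T_bound[OF i] by (intro directional_test_integrable) auto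
  then have "integrable (PM I \<Otimes>\<^sub>M lborel) (\<lambda>(x, s). v (x(n := s)) * T (x(n := s)) i)"
    by (subst (asm) PM_insert[OF fin nI], subst (asm) integrable_distr_eq) (auto simp: case_prod_unfold)
  from Bochner_Integration.integrable_minus[OF this]
  have k_int: "integrable (PM I \<Otimes>\<^sub>M lborel) ?k"
    by (simp add: case_prod_unfold)
  have eq: "- (\<integral>x. v x * T x i \<partial>PM J) = (\<integral>z. ?k z \<partial>(PM I \<Otimes>\<^sub>M lborel))"
    by (subst PM_insert[OF fin nI], subst integral_distr) (auto simp: case_prod_unfold)
  have "0 \<le> - (\<integral>x. v x * T x i \<partial>PM J) \<and>
    (\<integral>\<^sup>+x. ennreal (u x * t i x) \<partial>PM J) \<le> ennreal (- (\<integral>x. v x * T x i \<partial>PM J))"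
  proof (cases "i = n")
    case True
    have *: "AE x in PM I. 0 \<le> (\<integral>s. ?k (x, s) \<partial>lborel) \<and>
      (\<integral>\<^sup>+s. ennreal (u (x(n := s)) * t i (x(n := s))) \<partial>lborel) \<le> ennreal (\<integral>s. ?k (x, s) \<partial>lborel)"
      using AE_space AE_good
    proof eventually_elim
      case (elim x)
      interpret S: transport_pair "p x" "q (T' x)" r by (rule slice_pair) fact+
      note xJ = fun_upd_space_PM[OF elim(1), of n]
      have supp: "u (x(n := s)) = 0" "v (x(n := s)) = 0" if "B < \<bar>s\<bar>" for s
        using BC(2)[OF xJ[of s]] that by auto
      have *: "(\<integral>s. ?k (x, s) \<partial>lborel) = - (\<integral>s. v (x(n := s)) * mono_transport (p x) (q (T' x)) r s \<partial>lborel)"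
        by (subst Bochner_Integration.integral_minus[symmetric]) (simp add: T_upd elim True S_def)
      have **: "(\<integral>\<^sup>+s. ennreal (u (x(n := s)) * t i (x(n := s))) \<partial>lborel) =
        (\<integral>\<^sup>+s. ennreal (u (x(n := s)) * (p x s / q (T' x) (mono_transport (p x) (q (T' x)) r s))) \<partial>lborel)"
        using t_upd_n[OF elim(1)] True by (simp add: S_def)
      show ?case
        unfolding * **
        using S.transport_by_parts[where u="\<lambda>s. u (x(n := s))" and v="\<lambda>s. v (x(n := s))" and B=B]
          BC(1)[OF xJ] BC(3)[OF xJ[of 0]] BC(4)[OF xJ[of 0]] supp True by simp
    qed
    have int1: "integrable (PM I) (\<lambda>x. \<integral>s. ?k (x, s) \<partial>lborel)" by (rule P.integrable_fst'[OF k_int])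
    have eq1: "- (\<integral>x. v x * T x i \<partial>PM J) = (\<integral>x. (\<integral>s. ?k (x, s) \<partial>lborel) \<partial>PM I)"
      unfolding eq by (rule P.integral_fst'[OF k_int, symmetric])
    have "(\<integral>\<^sup>+x. ennreal (u x * t i x) \<partial>PM J) = (\<integral>\<^sup>+x. (\<integral>\<^sup>+s. ennreal (u (x(n := s)) * t i (x(n := s))) \<partial>lborel) \<partial>PM I)"
      by (rule nn_split) measurable
    also have "\<dots> \<le> (\<integral>\<^sup>+x. ennreal (\<integral>s. ?k (x, s) \<partial>lborel) \<partial>PM I)"
      using * by (intro nn_integral_mono_AE) auto
    also have "\<dots> = ennreal (\<integral>x. (\<integral>s. ?k (x, s) \<partial>lborel) \<partial>PM I)"
      using int1 * by (intro nn_integral_eq_integral) auto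
    finally have "(\<integral>\<^sup>+x. ennreal (u x * t i x) \<partial>PM J) \<le> ennreal (- (\<integral>x. v x * T x i \<partial>PM J))"
      unfolding eq1 .
    moreover have "0 \<le> - (\<integral>x. v x * T x i \<partial>PM J)"
      unfolding eq1 by (rule integral_nonneg_AE) (use * in eventually_elim, simp)
    ultimately show ?thesis by simp
  next
    case False
    then have iI: "i \<in> I" using i by auto
    have *: "0 \<le> (\<integral>x. ?k (x, s) \<partial>PM I) \<and>
      (\<integral>\<^sup>+x. ennreal (u (x(n := s)) * t i (x(n := s))) \<partial>PM I) \<le> ennreal (\<integral>x. ?k (x, s) \<partial>PM I)" for s
    proof -
      have 1: "(\<integral>x. ?k (x, s) \<partial>PM I) = - (\<integral>x. v (x(n := s)) * T' x i \<partial>PM I)"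
        by (subst Bochner_Integration.integral_minus[symmetric], rule Bochner_Integration.integral_cong)
          (use False in \<open>auto simp: T_upd\<close>)
      have 2: "(\<integral>\<^sup>+x. ennreal (u (x(n := s)) * t i (x(n := s))) \<partial>PM I) = (\<integral>\<^sup>+x. ennreal (u (x(n := s)) * t' i x) \<partial>PM I)"
        by (rule nn_integral_cong) (simp add: t_upd iI)
      show ?thesis unfolding 1 2
        using T'_test[OF iI directional_test_slice[OF uv iI, of s]] by simp
    qed
    have int1: "integrable lborel (\<lambda>s. \<integral>x. ?k (x, s) \<partial>PM I)"
      by (rule P.integrable_snd) (use k_int in simp)
    have eq1: "- (\<integral>x. v x * T x i \<partial>PM J) = (\<integral>s. (\<integral>x. ?k (x, s) \<partial>PM I) \<partial>lborel)"
      unfolding eq using P.integral_snd[of "\<lambda>x s. ?k (x, s)"] k_int by simp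
    have "(\<integral>\<^sup>+x. ennreal (u x * t i x) \<partial>PM J) = (\<integral>\<^sup>+s. (\<integral>\<^sup>+x. ennreal (u (x(n := s)) * t i (x(n := s))) \<partial>PM I) \<partial>lborel)"
      using fin nI by (intro PMs.product_nn_integral_insert_rev) measurable
    also have "\<dots> \<le> (\<integral>\<^sup>+s. ennreal (\<integral>x. ?k (x, s) \<partial>PM I) \<partial>lborel)"
      using * by (intro nn_integral_mono) auto
    also have "\<dots> = ennreal (\<integral>s. (\<integral>x. ?k (x, s) \<partial>PM I) \<partial>lborel)"
      using int1 * by (intro nn_integral_eq_integral) auto
    finally have "(\<integral>\<^sup>+x. ennreal (u x * t i x) \<partial>PM J) \<le> ennreal (- (\<integral>x. v x * T x i \<partial>PM J))"
      unfolding eq1 .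
    moreover have "0 \<le> - (\<integral>x. v x * T x i \<partial>PM J)"
      unfolding eq1 by (rule Bochner_Integration.integral_nonneg) (use * in simp)
    ultimately show ?thesis by simp
  qed
  then show "0 \<le> - (\<integral>x. v x * T x i \<partial>PM J)"
    "(\<integral>\<^sup>+x. ennreal (u x * t i x) \<partial>PM J) \<le> ennreal (- (\<integral>x. v x * T x i \<partial>PM J))" by auto
qed

lemma t_nonneg: "i \<in> J \<Longrightarrow> x \<in> space (PM J) \<Longrightarrow> 0 \<le> t i x"
proof -
  assume i: "i \<in> J" and x: "x \<in> space (PM J)"
  have x': "restrict x I \<in> space (PM I)" by (simp add: space_PM)
  show "0 \<le> t i x"
    using t'_nonneg[OF _ x', of i] i \<rho>'_pos[OF x'] \<rho>_pos[OF fun_upd_space_PM[OF x']]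
      f_nonneg[OF fun_upd_space_PM[OF T'_space[OF x']]]
    by (auto simp: t_def p_def q_def marg_def less_imp_le intro!: divide_nonneg_nonneg)
qed

lemma knothe_map_step: "knothe_map J \<rho> f r T t"
  unfolding knothe_map_def
  by (intro conjI ballI allI impI) (assumption | rule T_meas t_meas t_nonneg T_bound T_push t_prod T_test)+

end

lemma knothe_map_exists:
  assumes "finite I" "prob_dens I \<rho>" "\<And>x. x \<in> space (PM I) \<Longrightarrow> 0 < \<rho> x" "prob_dens I f"
    and "\<And>x. x \<in> space (PM I) \<Longrightarrow> \<exists>j\<in>I. r < \<bar>x j\<bar> \<Longrightarrow> f x = 0" "0 \<le> r"
  shows "\<exists>T t. knothe_map I \<rho> f r T t"
  using assms
proof (induction I arbitrary: \<rho> f rule: finite_induct)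
  case empty
  have sp: "space (PM {}) = {\<lambda>_. undefined}" by (simp add: space_PiM)
  \<comment> \<open>The space over the empty index set is a single point of mass one, so both
    densities equal 1 there and their quotient agrees with the empty product.\<close>
  have one: "g (\<lambda>_. undefined) = 1" if "prob_dens {} g" for g :: "('a \<Rightarrow> real) \<Rightarrow> real"
    using that by (auto simp: prob_dens_def PMs.nn_integral_empty sp)
  have "knothe_map {} \<rho> f r (\<lambda>x. x) (\<lambda>_ _. 1)"
    using one[OF empty(1)] one[OF empty(3)]
    by (auto simp: knothe_map_def PMs.nn_integral_empty sp intro!: AE_I2)
  then show ?case by blast
next
  case (insert n I)
  have "\<exists>T t. knothe_map I (pmarg n \<rho>) (marg n f) r T t"
  proof (rule insert.IH)
    show "prob_dens I (pmarg n \<rho>)" by (rule prob_dens_pmarg) fact+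
    show "prob_dens I (marg n f)" by (rule prob_dens_marg) fact+
    show "0 < pmarg n \<rho> x" if "x \<in> space (PM I)" for x
      by (rule pmarg_pos) (use insert that in \<open>auto simp: prob_dens_def\<close>)
    show "marg n f x = 0" if x: "x \<in> space (PM I)" "\<exists>j\<in>I. r < \<bar>x j\<bar>" for x
    proof -
      have "f (x(n := s)) = 0" for s
        by (rule insert.prems(4)[OF fun_upd_space_PM[OF x(1)]]) (use x(2) insert.hyps in auto)
      then show ?thesis by (simp add: marg_def)
    qed
    show "0 \<le> r" by fact
  qed
  then obtain T' t' where "knothe_map I (pmarg n \<rho>) (marg n f) r T' t'" by blast
  then interpret knothe_step I n \<rho> f r T' t'
    by unfold_locales (use insert in auto)
  show ?case using knothe_map_step by blast
qed

section \<open>Transport in Euclidean space\<close>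

text \<open>Weighted AM-GM with weight \<open>1 / a\<close> on each \<open>t i\<close> and the
  remaining weight \<open>(a - real (card I)) / a\<close> on the number 1. With \<open>p\<close> the
  geometric mean, the tangent bound \<open>ln y \<le> y - 1\<close> is applied at each
  \<open>t i / p\<close> and at \<open>1 / p\<close>; in the weighted sum the logarithms
  cancel.\<close>

lemma amgm_powr:
  fixes t :: "'i \<Rightarrow> real"
  assumes "finite I" "\<And>i. i \<in> I \<Longrightarrow> 0 \<le> t i" "real (card I) \<le> a" "0 < a"
  shows "a * (\<Prod>i\<in>I. t i) powr (1 / a) \<le> a - real (card I) + (\<Sum>i\<in>I. t i)"
proof (cases "\<exists>i\<in>I. t i = 0")
  case True
  then have "(\<Prod>i\<in>I. t i) = 0" using assms(1) by (simp add: prod_zero_iff)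
  moreover have "0 \<le> (\<Sum>i\<in>I. t i)" using assms(2) by (rule sum_nonneg)
  ultimately show ?thesis using assms(3,4) by simp
next
  case False
  then have pos: "0 < t i" if "i \<in> I" for i using assms(2)[OF that] that by force
  define p where "p = (\<Prod>i\<in>I. t i) powr (1 / a)"
  have P: "0 < (\<Prod>i\<in>I. t i)" using pos by (rule prod_pos)
  have p: "0 < p" using P by (simp add: p_def)
  have "a * ln p = ln (\<Prod>i\<in>I. t i)" using P assms(4) by (simp add: p_def ln_powr)
  also have "\<dots> = (\<Sum>i\<in>I. ln (t i))" by (intro ln_prod) (use assms(1) pos in \<open>fastforce+\<close>)
  finally have lnp: "a * ln p = (\<Sum>i\<in>I. ln (t i))" .
  have 1: "ln (t i) - ln p \<le> t i / p - 1" if "i \<in> I" for i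
    using ln_le_minus_one[of "t i / p"] pos[OF that] p by (simp add: ln_div)
  have "(\<Sum>i\<in>I. ln (t i) - ln p) \<le> (\<Sum>i\<in>I. t i / p - 1)" using 1 by (rule sum_mono)
  then have 2: "a * ln p - real (card I) * ln p \<le> (\<Sum>i\<in>I. t i) / p - real (card I)"
    by (simp add: sum_subtractf lnp sum_divide_distrib)
  have 3: "(a - real (card I)) * (- ln p) \<le> (a - real (card I)) * (1 / p - 1)"
    using ln_le_minus_one[of "1 / p"] p assms(3) by (intro mult_left_mono) (auto simp: ln_div)
  have "0 \<le> (\<Sum>i\<in>I. t i) / p + (a - real (card I)) / p - a"
    using 2 3 by (simp add: algebra_simps diff_divide_distrib)
  then have "a \<le> ((\<Sum>i\<in>I. t i) + (a - real (card I))) / p" by (simp add: add_divide_distrib)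
  then have "a * p \<le> (\<Sum>i\<in>I. t i) + (a - real (card I))" using p by (simp add: pos_le_divide_eq)
  then show ?thesis unfolding p_def by simp
qed

section \<open>Test functions and coordinates in Euclidean space\<close>

definition C1_bump :: "('a::euclidean_space \<Rightarrow> real) \<Rightarrow> ('a \<Rightarrow> 'a) \<Rightarrow> bool" where
  "C1_bump u Du \<longleftrightarrow> (\<forall>x. 0 \<le> u x) \<and> (\<forall>x. GDERIV u x :> Du x) \<and> continuous_on UNIV Du \<and>
     (\<exists>B. \<forall>x. B < norm x \<longrightarrow> u x = 0 \<and> Du x = 0)"

definition of_coords :: "('a::euclidean_space \<Rightarrow> real) \<Rightarrow> 'a" where
  "of_coords w = (\<Sum>b\<in>Basis. w b *\<^sub>R b)"

definition coords :: "'a::euclidean_space \<Rightarrow> 'a \<Rightarrow> real" where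
  "coords x = restrict (\<lambda>b. x \<bullet> b) Basis"

lemma of_coords_measurable [measurable]: "of_coords \<in> borel_measurable (PM Basis)"
  unfolding of_coords_def[abs_def] by measurable

lemma coords_measurable [measurable]: "coords \<in> borel \<rightarrow>\<^sub>M PM Basis"
  unfolding coords_def[abs_def] by measurable

lemma of_coords_inner: "b \<in> Basis \<Longrightarrow> of_coords w \<bullet> b = w b"
  by (simp add: of_coords_def)

lemma coords_of_coords: "w \<in> space (PM Basis) \<Longrightarrow> coords (of_coords w) = w"
  by (auto simp: coords_def of_coords_inner space_PM extensional_def fun_eq_iff)

lemma of_coords_upd: "b \<in> Basis \<Longrightarrow> of_coords (w(b := s)) = of_coords w + (s - w b) *\<^sub>R b"
  by (rule euclidean_eqI) (auto simp: of_coords_inner inner_add_left inner_Basis)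

lemma lborel_coords: "lborel = distr (PM Basis) borel of_coords"
  using lborel_eq by (simp add: of_coords_def[abs_def])

lemma nn_integral_coords:
  "h \<in> borel_measurable borel \<Longrightarrow> (\<integral>\<^sup>+x. h x \<partial>lborel) = (\<integral>\<^sup>+w. h (of_coords w) \<partial>PM Basis)"
  by (subst lborel_coords, subst nn_integral_distr) auto

lemma integral_coords:
  fixes h :: "'a::euclidean_space \<Rightarrow> real"
  shows "h \<in> borel_measurable borel \<Longrightarrow> (\<integral>x. h x \<partial>lborel) = (\<integral>w. h (of_coords w) \<partial>PM Basis)"
  by (subst lborel_coords, subst integral_distr) auto

lemma C1_bump_continuous:
  assumes "C1_bump u Du" shows "continuous_on UNIV u" "continuous_on UNIV Du"
  using assms unfolding C1_bump_def gderiv_def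
  by (auto intro!: continuous_at_imp_continuous_on has_derivative_continuous)

lemma continuous_compact_support_bounded:
  fixes w :: "'a::euclidean_space \<Rightarrow> 'b::real_normed_vector"
  assumes "continuous_on UNIV w" "\<And>x. B < norm x \<Longrightarrow> w x = 0"
  obtains C where "\<And>x. norm (w x) \<le> C"
proof -
  have "compact (w ` cball 0 B)"
    by (rule compact_continuous_image) (auto intro: continuous_on_subset[OF assms(1)])
  then obtain C where C: "\<And>x. x \<in> cball 0 B \<Longrightarrow> norm (w x) \<le> C"
    by (fastforce dest!: compact_imp_bounded simp: bounded_iff)
  have "norm (w x) \<le> max C 0" for x
    using C[of x] assms(2)[of x] by (cases "norm x \<le> B") auto
  then show thesis by (rule that)
qed

lemma integrable_continuous_compact_support:
  fixes w :: "'a::euclidean_space \<Rightarrow> real"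
  assumes "continuous_on UNIV w" "\<And>x. B < norm x \<Longrightarrow> w x = 0"
  shows "integrable lborel w"
proof -
  obtain C where C: "\<And>x. norm (w x) \<le> C"
    using continuous_compact_support_bounded[OF assms] by blast
  show ?thesis
    by (rule integrableI_bounded_set[where A="cball 0 B" and B=C])
      (use assms C emeasure_lborel_cball_finite in \<open>auto intro!: borel_measurable_continuous_onI simp: less_top\<close>)
qed

lemma C1_bump_directional_test:
  assumes u: "C1_bump u Du" and b: "b \<in> Basis"
  shows "directional_test Basis b (\<lambda>w. u (of_coords w)) (\<lambda>w. Du (of_coords w) \<bullet> b)"
proof -
  note cont = C1_bump_continuous[OF u]
  have [measurable]: "u \<in> borel_measurable borel" "Du \<in> borel_measurable borel"
    using cont by (auto intro: borel_measurable_continuous_onI)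
  obtain B where B: "\<And>x. B < norm x \<Longrightarrow> u x = 0 \<and> Du x = 0"
    and nn: "\<And>x. 0 \<le> u x" and D: "\<And>x. GDERIV u x :> Du x"
    using u unfolding C1_bump_def by metis
  obtain C where C: "\<And>x. norm (Du x) \<le> C"
    using continuous_compact_support_bounded[OF cont(2)] B by blast
  show ?thesis
    unfolding directional_test_def
  proof (intro conjI ballI allI)
    show "\<exists>B C. \<forall>w\<in>space (PM Basis). \<bar>Du (of_coords w) \<bullet> b\<bar> \<le> C \<and>
        ((\<exists>j\<in>Basis. B < \<bar>w j\<bar>) \<longrightarrow> u (of_coords w) = 0 \<and> Du (of_coords w) \<bullet> b = 0)"
    proof (rule exI[of _ B], rule exI[of _ C], intro ballI conjI impI)
      fix w :: "'a \<Rightarrow> real"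
      show "\<bar>Du (of_coords w) \<bullet> b\<bar> \<le> C"
        using Basis_le_norm[OF b, of "Du (of_coords w)"] C[of "of_coords w"] by linarith
      assume "\<exists>j\<in>Basis. B < \<bar>w j\<bar>"
      then obtain j where j: "j \<in> Basis" "B < \<bar>w j\<bar>" by blast
      then have "B < norm (of_coords w)"
        using Basis_le_norm[OF j(1), of "of_coords w"] by (simp add: of_coords_inner)
      then show "u (of_coords w) = 0" "Du (of_coords w) \<bullet> b = 0" using B by auto
    qed
    fix w :: "'a \<Rightarrow> real"
    have "((\<lambda>s. u (of_coords w + (s - w b) *\<^sub>R b)) has_derivative
        (\<lambda>h. (h *\<^sub>R b) \<bullet> Du (of_coords w + (s - w b) *\<^sub>R b))) (at s)" for s
      using D[of "of_coords w + (s - w b) *\<^sub>R b"] unfolding gderiv_def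
      by (rule has_derivative_compose[rotated]) (auto intro!: derivative_eq_intros)
    then show "((\<lambda>s. u (of_coords (w(b := s)))) has_real_derivative Du (of_coords (w(b := s))) \<bullet> b) (at s)" for s
      unfolding has_field_derivative_def of_coords_upd[OF b]
      by (simp add: inner_commute mult.commute[of _ "_ \<bullet> _"])
    show "continuous_on UNIV (\<lambda>s. Du (of_coords (w(b := s))) \<bullet> b)"
      unfolding of_coords_upd[OF b]
      by (intro continuous_intros continuous_on_compose2[OF cont(2)]) auto
  qed (use nn in measurable)
qed

text \<open>Summing the directional bounds over the basis assembles the integral of
  \<open>Du x \<bullet> T x\<close>. The term with \<open>a - real DIM('a)\<close> comes from the
  weight that AM-GM puts on the number 1, integrated against \<open>u\<close>.\<close>

theorem knothe_transport:
  fixes \<rho> f :: "'a::euclidean_space \<Rightarrow> real"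
  assumes [measurable]: "\<rho> \<in> borel_measurable borel" "f \<in> borel_measurable borel"
    and pos: "\<And>x. 0 < \<rho> x" "\<And>x. 0 \<le> f x"
    and one: "(\<integral>\<^sup>+x. ennreal (\<rho> x) \<partial>lborel) = 1" "(\<integral>\<^sup>+x. ennreal (f x) \<partial>lborel) = 1"
    and supp: "\<And>x b. b \<in> Basis \<Longrightarrow> r < \<bar>x \<bullet> b\<bar> \<Longrightarrow> f x = 0" and r: "0 \<le> r"
    and a: "real DIM('a) \<le> a"
  obtains T where "T \<in> borel_measurable borel"
    and "\<And>x b. b \<in> Basis \<Longrightarrow> \<bar>T x \<bullet> b\<bar> \<le> r"
    and "\<And>h. h \<in> borel_measurable borel \<Longrightarrow>
        (\<integral>\<^sup>+x. h (T x) * ennreal (\<rho> x) \<partial>lborel) = (\<integral>\<^sup>+y. h y * ennreal (f y) \<partial>lborel)"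
    and "\<And>u Du. C1_bump u Du \<Longrightarrow>
        0 \<le> (a - real DIM('a)) * (\<integral>x. u x \<partial>lborel) - (\<integral>x. Du x \<bullet> T x \<partial>lborel) \<and>
        (\<integral>\<^sup>+x. ennreal (a * u x * (\<rho> x / f (T x)) powr (1 / a)) \<partial>lborel)
          \<le> ennreal ((a - real DIM('a)) * (\<integral>x. u x \<partial>lborel) - (\<integral>x. Du x \<bullet> T x \<partial>lborel))"
proof -
  have a_pos: "0 < a" using a DIM_positive[where 'a='a] by linarith
  have "\<exists>T t. knothe_map (Basis :: 'a set) (\<lambda>w. \<rho> (of_coords w)) (\<lambda>w. f (of_coords w)) r T t"
  proof (rule knothe_map_exists)
    show "prob_dens Basis (\<lambda>w. \<rho> (of_coords w))" "prob_dens Basis (\<lambda>w. f (of_coords w))"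
      using pos one by (auto simp: prob_dens_def nn_integral_coords less_imp_le)
    show "f (of_coords w) = 0" if "\<exists>j\<in>Basis. r < \<bar>w j\<bar>" for w :: "'a \<Rightarrow> real"
      using that supp by (auto simp: of_coords_inner)
  qed (use pos r in auto)
  then obtain T0 t0 where K: "knothe_map (Basis :: 'a set) (\<lambda>w. \<rho> (of_coords w)) (\<lambda>w. f (of_coords w)) r T0 t0"
    by blast
  have T0[measurable]: "T0 \<in> PM Basis \<rightarrow>\<^sub>M PM Basis"
    and t0[measurable]: "\<And>b. b \<in> Basis \<Longrightarrow> t0 b \<in> borel_measurable (PM Basis)"
    and t0_nn: "\<And>b w. b \<in> Basis \<Longrightarrow> w \<in> space (PM Basis) \<Longrightarrow> 0 \<le> t0 b w"
    and T0_bd: "\<And>b w. b \<in> Basis \<Longrightarrow> w \<in> space (PM Basis) \<Longrightarrow> \<bar>T0 w b\<bar> \<le> r"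
    and push: "\<And>h. h \<in> borel_measurable (PM Basis) \<Longrightarrow>
      (\<integral>\<^sup>+w. h (T0 w) * ennreal (\<rho> (of_coords w)) \<partial>PM Basis) = (\<integral>\<^sup>+w. h w * ennreal (f (of_coords w)) \<partial>PM Basis)"
    and prod: "AE w in PM Basis. (\<Prod>b\<in>Basis. t0 b w) = \<rho> (of_coords w) / f (of_coords (T0 w))"
    and test: "\<And>b u v. b \<in> Basis \<Longrightarrow> directional_test Basis b u v \<Longrightarrow> 0 \<le> - (\<integral>w. v w * T0 w b \<partial>PM Basis)"
      "\<And>b u v. b \<in> Basis \<Longrightarrow> directional_test Basis b u v \<Longrightarrow>
        (\<integral>\<^sup>+w. ennreal (u w * t0 b w) \<partial>PM Basis) \<le> ennreal (- (\<integral>w. v w * T0 w b \<partial>PM Basis))"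
    using K unfolding knothe_map_def by blast+
  define T where "T x = of_coords (T0 (coords x))" for x
  have T_coords: "T (of_coords w) = of_coords (T0 w)" if "w \<in> space (PM Basis)" for w
    using that by (simp add: T_def coords_of_coords)
  have T_meas[measurable]: "T \<in> borel_measurable borel" unfolding T_def[abs_def] by measurable
  have coords_sp: "coords x \<in> space (PM Basis)" for x :: 'a by (simp add: coords_def space_PM)
  show thesis
  proof (rule that[OF T_meas])
    show "\<bar>T x \<bullet> b\<bar> \<le> r" if "b \<in> Basis" for x b
      using T0_bd[OF that coords_sp] that by (simp add: T_def of_coords_inner)
    show "(\<integral>\<^sup>+x. h (T x) * ennreal (\<rho> x) \<partial>lborel) = (\<integral>\<^sup>+y. h y * ennreal (f y) \<partial>lborel)"
      if [measurable]: "h \<in> borel_measurable borel" for h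
    proof -
      have "(\<integral>\<^sup>+x. h (T x) * ennreal (\<rho> x) \<partial>lborel) = (\<integral>\<^sup>+w. h (T (of_coords w)) * ennreal (\<rho> (of_coords w)) \<partial>PM Basis)"
        by (rule nn_integral_coords) measurable
      also have "\<dots> = (\<integral>\<^sup>+w. h (of_coords (T0 w)) * ennreal (\<rho> (of_coords w)) \<partial>PM Basis)"
        by (rule nn_integral_cong) (simp add: T_coords)
      also have "\<dots> = (\<integral>\<^sup>+w. h (of_coords w) * ennreal (f (of_coords w)) \<partial>PM Basis)"
        by (rule push) measurable
      also have "\<dots> = (\<integral>\<^sup>+y. h y * ennreal (f y) \<partial>lborel)"
        by (rule nn_integral_coords[symmetric]) measurable
      finally show ?thesis .
    qed
    fix u :: "'a \<Rightarrow> real" and Du assume u: "C1_bump u Du"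
    note cont = C1_bump_continuous[OF u]
    have [measurable]: "u \<in> borel_measurable borel" "Du \<in> borel_measurable borel"
      using cont by (auto intro: borel_measurable_continuous_onI)
    obtain B where B: "\<And>x. B < norm x \<Longrightarrow> u x = 0" and nn: "\<And>x. 0 \<le> u x"
      using u unfolding C1_bump_def by metis
    have u_int: "integrable lborel u" using cont(1) B by (rule integrable_continuous_compact_support)
    note dt = C1_bump_directional_test[OF u]
    have [measurable]: "(\<lambda>w. T0 w b) \<in> borel_measurable (PM Basis)" if "b \<in> Basis" for b
      using measurable_comp[OF T0 measurable_component_singleton[of b Basis "\<lambda>_. lborel"]] that by (simp add: comp_def)
    have int: "integrable (PM Basis) (\<lambda>w. (Du (of_coords w) \<bullet> b) * T0 w b)" if "b \<in> Basis" for b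
      by (rule directional_test_integrable[OF dt[OF that]]) (use that T0_bd in auto)
    have "(\<Sum>b\<in>Basis. - (\<integral>w. (Du (of_coords w) \<bullet> b) * T0 w b \<partial>PM Basis)) = - (\<integral>w. (\<Sum>b\<in>Basis. (Du (of_coords w) \<bullet> b) * T0 w b) \<partial>PM Basis)"
      using int by (subst Bochner_Integration.integral_sum) (auto simp: sum_negf)
    also have "(\<integral>w. (\<Sum>b\<in>Basis. (Du (of_coords w) \<bullet> b) * T0 w b) \<partial>PM Basis) = (\<integral>w. Du (of_coords w) \<bullet> T (of_coords w) \<partial>PM Basis)"
    proof (rule Bochner_Integration.integral_cong)
      fix w :: "'a \<Rightarrow> real" assume "w \<in> space (PM Basis)"
      then show "(\<Sum>b\<in>Basis. (Du (of_coords w) \<bullet> b) * T0 w b) = Du (of_coords w) \<bullet> T (of_coords w)"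
        unfolding euclidean_inner[of "Du (of_coords w)" "T (of_coords w)"]
        by (intro sum.cong) (simp_all add: T_coords of_coords_inner)
    qed simp
    also have "(\<integral>w. Du (of_coords w) \<bullet> T (of_coords w) \<partial>PM Basis) = (\<integral>x. Du x \<bullet> T x \<partial>lborel)"
      by (rule integral_coords[symmetric]) measurable
    finally have sum_eq: "(\<Sum>b\<in>Basis. - (\<integral>w. (Du (of_coords w) \<bullet> b) * T0 w b \<partial>PM Basis)) = - (\<integral>x. Du x \<bullet> T x \<partial>lborel)" .
    have sum_nn: "0 \<le> (\<Sum>b\<in>Basis. - (\<integral>w. (Du (of_coords w) \<bullet> b) * T0 w b \<partial>PM Basis))"
      by (intro sum_nonneg test(1)[OF _ dt])
    have u_nn: "0 \<le> (a - real DIM('a)) * (\<integral>x. u x \<partial>lborel)"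
      using nn a by (intro mult_nonneg_nonneg Bochner_Integration.integral_nonneg) auto
    have "(\<integral>\<^sup>+x. ennreal (a * u x * (\<rho> x / f (T x)) powr (1 / a)) \<partial>lborel)
      = (\<integral>\<^sup>+w. ennreal (a * u (of_coords w) * (\<rho> (of_coords w) / f (T (of_coords w))) powr (1 / a)) \<partial>PM Basis)"
      by (rule nn_integral_coords) measurable
    also have "\<dots> \<le> (\<integral>\<^sup>+w. ennreal ((a - real DIM('a)) * u (of_coords w)) + (\<Sum>b\<in>Basis. ennreal (u (of_coords w) * t0 b w)) \<partial>PM Basis)"
    proof (rule nn_integral_mono_AE)
      show "AE w in PM Basis. ennreal (a * u (of_coords w) * (\<rho> (of_coords w) / f (T (of_coords w))) powr (1 / a))
        \<le> ennreal ((a - real DIM('a)) * u (of_coords w)) + (\<Sum>b\<in>Basis. ennreal (u (of_coords w) * t0 b w))"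
        using AE_space prod
      proof eventually_elim
        case (elim w)
        have "a * (\<Prod>b\<in>Basis. t0 b w) powr (1 / a) \<le> a - real DIM('a) + (\<Sum>b\<in>Basis. t0 b w)"
          by (rule amgm_powr) (use t0_nn elim a a_pos in auto)
        from mult_left_mono[OF this nn[of "of_coords w"]]
        have "a * u (of_coords w) * (\<rho> (of_coords w) / f (T (of_coords w))) powr (1 / a)
          \<le> (a - real DIM('a)) * u (of_coords w) + (\<Sum>b\<in>Basis. u (of_coords w) * t0 b w)"
          using elim by (simp add: T_coords algebra_simps sum_distrib_left)
        then have "ennreal (a * u (of_coords w) * (\<rho> (of_coords w) / f (T (of_coords w))) powr (1 / a))
          \<le> ennreal ((a - real DIM('a)) * u (of_coords w) + (\<Sum>b\<in>Basis. u (of_coords w) * t0 b w))"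
          by (rule ennreal_leI)
        also have "\<dots> = ennreal ((a - real DIM('a)) * u (of_coords w)) + (\<Sum>b\<in>Basis. ennreal (u (of_coords w) * t0 b w))"
          using nn a t0_nn elim by (subst ennreal_plus) (auto intro!: sum_nonneg mult_nonneg_nonneg simp: sum_ennreal)
        finally show ?case .
      qed
    qed
    also have "\<dots> = (\<integral>\<^sup>+w. ennreal ((a - real DIM('a)) * u (of_coords w)) \<partial>PM Basis) + (\<Sum>b\<in>Basis. \<integral>\<^sup>+w. ennreal (u (of_coords w) * t0 b w) \<partial>PM Basis)"
      by (subst nn_integral_add) (auto intro!: borel_measurable_sum simp: nn_integral_sum)
    also have "(\<integral>\<^sup>+w. ennreal ((a - real DIM('a)) * u (of_coords w)) \<partial>PM Basis) = (\<integral>\<^sup>+x. ennreal ((a - real DIM('a)) * u x) \<partial>lborel)"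
      by (rule nn_integral_coords[symmetric]) measurable
    also have "\<dots> = ennreal ((a - real DIM('a)) * (\<integral>x. u x \<partial>lborel))"
      using u_int nn a by (subst nn_integral_eq_integral) auto
    also have "\<dots> + (\<Sum>b\<in>Basis. \<integral>\<^sup>+w. ennreal (u (of_coords w) * t0 b w) \<partial>PM Basis)
      \<le> ennreal ((a - real DIM('a)) * (\<integral>x. u x \<partial>lborel)) + (\<Sum>b\<in>Basis. ennreal (- (\<integral>w. (Du (of_coords w) \<bullet> b) * T0 w b \<partial>PM Basis)))"
      by (intro add_left_mono sum_mono test(2) dt)
    also have "\<dots> = ennreal ((a - real DIM('a)) * (\<integral>x. u x \<partial>lborel) + (\<Sum>b\<in>Basis. - (\<integral>w. (Du (of_coords w) \<bullet> b) * T0 w b \<partial>PM Basis)))"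
      using nn a test(1)[OF _ dt]
      by (subst sum_ennreal, simp, subst ennreal_plus) (auto intro!: sum_nonneg mult_nonneg_nonneg Bochner_Integration.integral_nonneg)
    finally show "0 \<le> (a - real DIM('a)) * (\<integral>x. u x \<partial>lborel) - (\<integral>x. Du x \<bullet> T x \<partial>lborel) \<and>
        (\<integral>\<^sup>+x. ennreal (a * u x * (\<rho> x / f (T x)) powr (1 / a)) \<partial>lborel)
          \<le> ennreal ((a - real DIM('a)) * (\<integral>x. u x \<partial>lborel) - (\<integral>x. Du x \<bullet> T x \<partial>lborel))"
      using sum_nn u_nn by (simp add: sum_eq)
  qed
qed

section \<open>Cut-off functions and the radial divergence theorem\<close>

text \<open>This is the divergence theorem for the field \<open>u x *\<^sub>R x\<close>. On a line
  in direction \<open>b\<close> the coordinate \<open>s\<close> times \<open>u\<close> has compact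
  support, so its derivative \<open>u + s * (Du \<bullet> b)\<close> has integral 0; the sum over
  the basis gives the claim.\<close>

lemma integral_radial_divergence:
  fixes u :: "'a::euclidean_space \<Rightarrow> real"
  assumes u: "C1_bump u Du"
  shows "real DIM('a) * (\<integral>x. u x \<partial>lborel) + (\<integral>x. Du x \<bullet> x \<partial>lborel) = 0"
proof -
  note cont = C1_bump_continuous[OF u]
  have [measurable]: "u \<in> borel_measurable borel" "Du \<in> borel_measurable borel"
    using cont by (auto intro: borel_measurable_continuous_onI)
  obtain B where B: "\<And>x. B < norm x \<Longrightarrow> u x = 0 \<and> Du x = 0"
    using u unfolding C1_bump_def by metis
  have u_int: "integrable lborel u"
    by (rule integrable_continuous_compact_support[OF cont(1)]) (use B in auto)
  have d_int: "integrable lborel (\<lambda>x. (Du x \<bullet> b) * (x \<bullet> b))" for b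
    by (rule integrable_continuous_compact_support[where B=B])
      (use B in \<open>auto intro!: continuous_intros cont(2)\<close>)
  have coord: "(\<integral>x. u x + (Du x \<bullet> b) * (x \<bullet> b) \<partial>lborel) = 0" if b: "b \<in> Basis" for b
  proof -
    let ?h = "\<lambda>x. u x + (Du x \<bullet> b) * (x \<bullet> b)"
    let ?I = "Basis - {b}"
    have ins: "insert b ?I = Basis" using b by auto
    have h_int: "integrable lborel ?h" using u_int d_int by simp
    then have h_int': "integrable (PM Basis) (\<lambda>w. ?h (of_coords w))"
      by (subst (asm) lborel_coords, subst (asm) integrable_distr_eq) auto
    have "(\<integral>x. ?h x \<partial>lborel) = (\<integral>w. ?h (of_coords w) \<partial>PM (insert b ?I))"
      unfolding ins by (rule integral_coords) measurable
    also have "\<dots> = (\<integral>w. (\<integral>s. ?h (of_coords (w(b := s))) \<partial>lborel) \<partial>PM ?I)"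
    proof (rule PMs.product_integral_insert)
      show "integrable (PM (insert b ?I)) (\<lambda>w. ?h (of_coords w))" unfolding ins by (rule h_int')
    qed simp_all
    also have "\<dots> = (\<integral>w. 0 \<partial>PM ?I)"
    proof (rule Bochner_Integration.integral_cong)
      fix w :: "'a \<Rightarrow> real" assume "w \<in> space (PM ?I)"
      \<comment> \<open>\<open>w\<close> has no coordinate at \<open>b\<close>; the value 0 is a
        placeholder that makes it a point of the full product, and every later update by
        \<open>s\<close> overwrites it.\<close>
      from fun_upd_space_PM[OF this, of b 0] have w: "w(b := 0) \<in> space (PM Basis)" unfolding ins .
      have dt: "((\<lambda>s. u (of_coords (w(b := s)))) has_real_derivative Du (of_coords (w(b := s))) \<bullet> b) (at s)"
        and dc: "continuous_on UNIV (\<lambda>s. Du (of_coords (w(b := s))) \<bullet> b)" for s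
      proof -
        have "((\<lambda>s. u (of_coords ((w(b := 0))(b := s)))) has_real_derivative Du (of_coords ((w(b := 0))(b := s))) \<bullet> b) (at s)"
          "continuous_on UNIV (\<lambda>s. Du (of_coords ((w(b := 0))(b := s))) \<bullet> b)"
          using C1_bump_directional_test[OF u b] w unfolding directional_test_def by blast+
        then show "((\<lambda>s. u (of_coords (w(b := s)))) has_real_derivative Du (of_coords (w(b := s))) \<bullet> b) (at s)"
          "continuous_on UNIV (\<lambda>s. Du (of_coords (w(b := s))) \<bullet> b)" by simp_all
      qed
      have uc: "continuous_on UNIV (\<lambda>s. u (of_coords (w(b := s))))"
        using dt by (auto intro!: continuous_at_imp_continuous_on intro: DERIV_isCont)
      have supp: "u (of_coords (w(b := s))) = 0 \<and> Du (of_coords (w(b := s))) = 0" if "B < \<bar>s\<bar>" for s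
        using B[of "of_coords (w(b := s))"] Basis_le_norm[OF b, of "of_coords (w(b := s))"] that
        by (simp add: of_coords_inner[OF b])
      show "(\<integral>s. ?h (of_coords (w(b := s))) \<partial>lborel) = 0"
      proof (rule integral_deriv_compact_support(2)[where B=B])
        show "((\<lambda>s. s * u (of_coords (w(b := s)))) has_real_derivative ?h (of_coords (w(b := s)))) (at s)" for s
          by (rule derivative_eq_intros dt refl)+ (simp add: of_coords_inner[OF b])
        show "continuous_on UNIV (\<lambda>s. ?h (of_coords (w(b := s))))"
          by (simp add: of_coords_inner[OF b]) (intro continuous_intros uc dc)
      qed (use supp in simp_all)
    qed simp
    finally show ?thesis by simp
  qed
  have "0 = (\<Sum>b\<in>(Basis::'a set). (\<integral>x. u x + (Du x \<bullet> b) * (x \<bullet> b) \<partial>lborel))"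
    by (simp add: coord)
  also have "\<dots> = real DIM('a) * (\<integral>x. u x \<partial>lborel) + (\<Sum>b\<in>Basis. (\<integral>x. (Du x \<bullet> b) * (x \<bullet> b) \<partial>lborel))"
    using u_int d_int by (simp add: sum.distrib)
  also have "(\<Sum>b\<in>Basis. (\<integral>x. (Du x \<bullet> b) * (x \<bullet> b) \<partial>lborel)) = (\<integral>x. Du x \<bullet> x \<partial>lborel)"
  proof -
    have "(\<integral>x. Du x \<bullet> x \<partial>lborel) = (\<integral>x. (\<Sum>b\<in>Basis. (Du x \<bullet> b) * (x \<bullet> b)) \<partial>lborel)"
      by (rule Bochner_Integration.integral_cong[OF refl euclidean_inner])
    then show ?thesis using d_int by (simp add: Bochner_Integration.integral_sum)
  qed
  finally show ?thesis by simp
qed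

lemma DERIV_pos_part_sq: "((\<lambda>s::real. (max 0 s)\<^sup>2) has_real_derivative 2 * max 0 s) (at s)"
proof -
  consider "0 < s" | "s < 0" | "s = 0" by linarith
  then show ?thesis
  proof cases
    case 1
    have "((\<lambda>s::real. s\<^sup>2) has_real_derivative 2 * max 0 s) (at s)"
      using 1 by (auto intro!: derivative_eq_intros)
    then show ?thesis
      by (rule has_field_derivative_transform_within_open[where S="{0<..}"]) (use 1 in auto)
  next
    case 2
    have "((\<lambda>s::real. 0) has_real_derivative 2 * max 0 s) (at s)"
      using 2 by (auto intro!: derivative_eq_intros)
    then show ?thesis
      by (rule has_field_derivative_transform_within_open[where S="{..<0}"]) (use 2 in auto)
  next
    case 3
    have "((\<lambda>h::real. (max 0 h)\<^sup>2 / h) \<longlongrightarrow> 0) (at 0)"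
    proof (rule Lim_null_comparison)
      show "eventually (\<lambda>h::real. norm ((max 0 h)\<^sup>2 / h) \<le> \<bar>h\<bar>) (at 0)"
        by (rule always_eventually) (auto simp: max_def power2_eq_square)
      show "((\<lambda>h::real. \<bar>h\<bar>) \<longlongrightarrow> 0) (at 0)" by (rule tendsto_rabs_zero) (rule tendsto_ident_at)
    qed
    then show ?thesis using 3 by (simp add: DERIV_def)
  qed
qed

text \<open>Squaring makes the positive part continuously differentiable, and the dependence through
  \<open>x \<bullet> x\<close> avoids a singularity at the origin and gives an explicit gradient.
  The radius is \<open>Suc j\<close>, so it is never 0.\<close>

definition cutoff :: "nat \<Rightarrow> 'a::euclidean_space \<Rightarrow> real" where
  "cutoff j x = (max 0 (1 - (x \<bullet> x) / (real (Suc j))\<^sup>2))\<^sup>2"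

definition cutoff_grad :: "nat \<Rightarrow> 'a::euclidean_space \<Rightarrow> 'a" where
  "cutoff_grad j x = (- 4 / (real (Suc j))\<^sup>2 * max 0 (1 - (x \<bullet> x) / (real (Suc j))\<^sup>2)) *\<^sub>R x"

lemma cutoff_GDERIV: "GDERIV (cutoff j) x :> cutoff_grad j x"
proof -
  let ?R = "(real (Suc j))\<^sup>2"
  have "GDERIV (\<lambda>x::'a. 1 - (x \<bullet> x) / ?R) x :> (- 2 / ?R) *\<^sub>R x"
    unfolding gderiv_def
    by (auto intro!: derivative_eq_intros simp: inner_commute field_simps)
  from GDERIV_DERIV_compose[OF this DERIV_pos_part_sq]
  have "GDERIV (\<lambda>x::'a. (max 0 (1 - (x \<bullet> x) / ?R))\<^sup>2) x
      :> (2 * max 0 (1 - (x \<bullet> x) / ?R)) *\<^sub>R ((- 2 / ?R) *\<^sub>R x)" .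
  then show ?thesis
    unfolding cutoff_def[abs_def] cutoff_grad_def
    by (rule GDERIV_subst) (simp add: field_simps)
qed

lemma cutoff_grad_continuous: "continuous_on UNIV (cutoff_grad j)"
  unfolding cutoff_grad_def[abs_def] by (intro continuous_intros) auto

lemma cutoff_nonneg: "0 \<le> cutoff j x"
  by (simp add: cutoff_def)

lemma cutoff_le1: "cutoff j x \<le> 1"
  unfolding cutoff_def by (rule power_le_one) auto

lemma ratio_nonpos:
  fixes x :: "'a::euclidean_space"
  assumes "0 < R" "R < norm x" shows "max 0 (1 - (x \<bullet> x) / R\<^sup>2) = 0"
proof -
  have "R\<^sup>2 < (norm x)\<^sup>2" using assms by (intro power_strict_mono) auto
  then have "1 < (x \<bullet> x) / R\<^sup>2"
    unfolding dot_square_norm using assms(1) by (subst less_divide_eq_1_pos) auto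
  then show ?thesis by linarith
qed

lemma cutoff_supp:
  assumes "real (Suc j) < norm x" shows "cutoff j x = 0" "cutoff_grad j x = 0"
  unfolding cutoff_def cutoff_grad_def by (subst ratio_nonpos[OF _ assms], simp_all del: of_nat_Suc)+

text \<open>Two estimates for two vector fields. Against the bounded map \<open>T\<close> the decay
  with the inverse radius kills the boundary term; against the unbounded field \<open>x\<close>
  there is only a uniform bound, and dominated convergence does the rest.\<close>

lemma cutoff_grad_norm: "norm (cutoff_grad j x) \<le> 4 / real (Suc j)"
  and cutoff_grad_inner: "\<bar>cutoff_grad j x \<bullet> x\<bar> \<le> 4"
proof -
  obtain R where R: "R = real (Suc j)" and R_pos: "0 < R" by simp
  define m where "m = max 0 (1 - (x \<bullet> x) / R\<^sup>2)"
  have m: "0 \<le> m" "m \<le> 1" by (auto simp: m_def)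
  have cg: "cutoff_grad j x = (- 4 / R\<^sup>2 * m) *\<^sub>R x" by (simp only: cutoff_grad_def m_def R)
  show "norm (cutoff_grad j x) \<le> 4 / real (Suc j)"
  proof (cases "norm x \<le> R")
    case True
    have "norm (cutoff_grad j x) = 4 / R\<^sup>2 * (m * norm x)"
      using m by (simp add: cg abs_mult)
    also have "\<dots> \<le> 4 / R\<^sup>2 * (1 * R)"
      using m True by (intro mult_left_mono mult_mono) auto
    also have "\<dots> = 4 / R" by (simp add: power2_eq_square)
    finally show ?thesis by (simp only: R)
  next
    case False
    then show ?thesis by (subst cutoff_supp) (simp_all only: R, simp_all)
  qed
  show "\<bar>cutoff_grad j x \<bullet> x\<bar> \<le> 4"
  proof (cases "norm x \<le> R")
    case True
    have "\<bar>cutoff_grad j x \<bullet> x\<bar> = 4 / R\<^sup>2 * (m * (norm x)\<^sup>2)"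
      using m by (simp add: cg abs_mult dot_square_norm)
    also have "\<dots> \<le> 4 / R\<^sup>2 * (1 * R\<^sup>2)"
      using m True R_pos by (intro mult_left_mono mult_mono power_mono) auto
    also have "\<dots> = 4" using R_pos by simp
    finally show ?thesis .
  next
    case False
    then show ?thesis by (subst cutoff_supp) (simp_all only: R, simp_all)
  qed
qed

lemma cutoff_LIMSEQ: "(\<lambda>j. cutoff j x) \<longlonglongrightarrow> 1"
  and cutoff_grad_LIMSEQ: "(\<lambda>j. cutoff_grad j x) \<longlonglongrightarrow> 0"
proof -
  have q: "(\<lambda>j. (x \<bullet> x) / (real (Suc j))\<^sup>2) \<longlonglongrightarrow> 0" by real_asymp
  have "(\<lambda>j. (max 0 (1 - (x \<bullet> x) / (real (Suc j))\<^sup>2))\<^sup>2) \<longlonglongrightarrow> (max 0 (1 - 0))\<^sup>2"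
    by (intro tendsto_intros q)
  then show "(\<lambda>j. cutoff j x) \<longlonglongrightarrow> 1" by (simp add: cutoff_def)
  show "(\<lambda>j. cutoff_grad j x) \<longlonglongrightarrow> 0"
  proof (rule Lim_null_comparison)
    show "eventually (\<lambda>j. norm (cutoff_grad j x) \<le> 4 / real (Suc j)) sequentially"
      using cutoff_grad_norm by (rule always_eventually[OF allI])
    show "(\<lambda>j. 4 / real (Suc j)) \<longlonglongrightarrow> 0" by real_asymp
  qed
qed

lemma cutoff_measurable [measurable]:
  "cutoff j \<in> borel_measurable borel" "cutoff_grad j \<in> borel_measurable borel"
  unfolding cutoff_def[abs_def] cutoff_grad_def[abs_def] by measurable

lemma cutoff_mult_le: "norm (cutoff j x * h) \<le> norm (h :: real)"
  using mult_right_mono[OF cutoff_le1, of "\<bar>h\<bar>" j x] by (simp add: abs_mult cutoff_nonneg)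

lemma cutoff_mult_integrable:
  assumes "integrable lborel h" shows "integrable lborel (\<lambda>x. cutoff j x * h x :: real)"
  by (rule Bochner_Integration.integrable_bound[OF assms])
    (use assms cutoff_mult_le in auto)

lemma cutoff_integral_LIMSEQ:
  fixes h :: "'a::euclidean_space \<Rightarrow> real"
  assumes "integrable lborel h"
  shows "(\<lambda>j. \<integral>x. cutoff j x * h x \<partial>lborel) \<longlonglongrightarrow> (\<integral>x. h x \<partial>lborel)"
proof (rule integral_dominated_convergence[where w="\<lambda>x. norm (h x)"])
  show "AE x in lborel. (\<lambda>j. cutoff j x * h x) \<longlonglongrightarrow> h x"
  proof (rule AE_I2)
    fix x
    have "(\<lambda>j. cutoff j x * h x) \<longlonglongrightarrow> 1 * h x" by (intro tendsto_intros cutoff_LIMSEQ)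
    then show "(\<lambda>j. cutoff j x * h x) \<longlonglongrightarrow> h x" by simp
  qed
  show "AE x in lborel. norm (cutoff j x * h x) \<le> norm (h x)" for j
    by (rule AE_I2) (rule cutoff_mult_le)
qed (use assms in auto)

section \<open>The transport inequality\<close>

lemma
  fixes g :: "'a::euclidean_space \<Rightarrow> real"
  assumes "smooth g"
  shows smooth_GDERIV: "GDERIV g x :> grad g x"
    and smooth_grad_continuous: "continuous_on UNIV (grad g)"
proof -
  have "Ck (Suc 0) g" using assms unfolding smooth_def by blast
  then have diff: "g differentiable (at x)"
    and cont: "continuous_on UNIV (\<lambda>x. frechet_derivative g (at x) v)" for x v
    by simp_all
  \<comment> \<open>\<open>Ck\<close> gives continuity of the derivative for each fixed direction,
    so the gradient is assembled from the finitely many basis directions.\<close>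
  define D where "D x = (\<Sum>b\<in>Basis. frechet_derivative g (at x) b *\<^sub>R b)" for x
  have D: "GDERIV g x :> D x" for x
  proof -
    have der: "(g has_derivative frechet_derivative g (at x)) (at x)"
      using diff by (simp add: frechet_derivative_works)
    then have lin: "linear (frechet_derivative g (at x))" by (rule has_derivative_linear)
    have "frechet_derivative g (at x) = (\<lambda>h. h \<bullet> D x)"
    proof
      fix h
      have "frechet_derivative g (at x) h = frechet_derivative g (at x) (\<Sum>b\<in>Basis. (h \<bullet> b) *\<^sub>R b)"
        by (simp only: euclidean_representation)
      also have "\<dots> = (\<Sum>b\<in>Basis. (h \<bullet> b) * frechet_derivative g (at x) b)"
        by (simp only: linear_sum[OF lin] linear_scale[OF lin] real_scaleR_def o_def)
      also have "\<dots> = h \<bullet> D x"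
        by (simp only: D_def inner_sum_right inner_scaleR_right mult.commute)
      finally show "frechet_derivative g (at x) h = h \<bullet> D x" .
    qed
    then show ?thesis using der unfolding gderiv_def by simp
  qed
  have grad: "grad g x = D x" for x
    unfolding grad_def
  proof (rule the_equality)
    fix D' assume "GDERIV g x :> D'"
    then have "(\<lambda>h. h \<bullet> D') = (\<lambda>h. h \<bullet> D x)"
      using D[of x] unfolding gderiv_def by (rule has_derivative_unique)
    then have eq: "h \<bullet> D' = h \<bullet> D x" for h by (rule fun_cong)
    show "D' = D x"
      by (rule euclidean_eqI) (simp only: inner_commute[of D'] inner_commute[of "D x"] eq)
  qed (rule D)
  show "GDERIV g x :> grad g x" unfolding grad by (rule D)
  have "grad g = D" by (rule ext) (rule grad)
  then show "continuous_on UNIV (grad g)"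
    unfolding D_def[abs_def] by (auto intro!: continuous_intros cont)
qed

lemma legendre_ge: "ereal (x \<bullet> y - W x) \<le> legendre (\<lambda>z. ereal (W z)) y"
  unfolding legendre_def by (rule SUP_upper2[where i=x]) auto

text \<open>A supremum of affine functions of \<open>y\<close>, even an uncountable one, is lower
  semicontinuous whatever \<open>W\<close> is: its superlevel sets are unions of open sets.\<close>

lemma legendre_measurable [measurable]:
  fixes W :: "'a::euclidean_space \<Rightarrow> real"
  shows "legendre (\<lambda>z. ereal (W z)) \<in> borel_measurable borel"
proof (rule borel_measurableI_greater)
  fix c :: ereal
  have "{y. c < legendre (\<lambda>z. ereal (W z)) y} = (\<Union>x. {y. c < ereal (x \<bullet> y - W x)})"
    by (auto simp: legendre_def less_SUP_iff)
  moreover have "open {y. c < ereal (x \<bullet> y - W x)}" for x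
    by (intro open_Collect_less continuous_intros)
  ultimately show "{y \<in> space borel. c < legendre (\<lambda>z. ereal (W z)) y} \<in> sets borel"
    by (auto intro!: borel_open open_UN)
qed

lemma ereal_integral_AE_real:
  assumes v: "integrable lborel v" and eq: "AE x in lborel. f x = ereal (v x)"
  shows "ereal_integral lebesgue f = ereal (\<integral>x. v x \<partial>lborel)"
proof -
  have AE: "AE x in lebesgue. f x = ereal (v x)" using eq by (rule AE_completion)
  have "ereal_integral lebesgue f = ereal_integral lebesgue (\<lambda>x. ereal (v x))"
    unfolding ereal_integral_def
    by (intro arg_cong2[where f="(-)"] arg_cong[where f=enn2ereal] nn_integral_cong_AE)
      (use AE in \<open>eventually_elim, simp\<close>)+
  also have "\<dots> = ereal (\<integral>x. v x \<partial>lebesgue)"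
    using v by (intro ereal_integral_eq_lebesgue_integral) (simp add: integrable_completion)
  also have "(\<integral>x. v x \<partial>lebesgue) = (\<integral>x. v x \<partial>lborel)"
    using v by (intro integral_completion) auto
  finally show ?thesis .
qed

text \<open>\<open>g\<close> is continuous, so its integrals can be taken over
  \<open>lborel\<close>. \<open>W\<close> is merely positive here: its measurability is that of
  Lebesgue and enters only through restrictions to suitable Borel sets.\<close>

locale gradient_density =
  fixes a :: real and W g :: "'a::euclidean_space \<Rightarrow> real" and Dg :: "'a \<Rightarrow> 'a"
  assumes a_DIM: "real DIM('a) \<le> a" and a_gt1: "1 < a"
    and W_pos: "\<And>x. 0 < W x" and g_pos: "\<And>x. 0 < g x"
    and Dg: "\<And>x. GDERIV g x :> Dg x" and Dg_cont: "continuous_on UNIV Dg"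
    and g1_int: "integrable lborel (\<lambda>x. g x powr (1 - a))"
    and g_int: "integrable lborel (\<lambda>x. g x powr (- a))"
    and g_one: "(\<integral>x. g x powr (- a) \<partial>lborel) = 1"
begin

lemma g_cont: "continuous_on UNIV g"
  using Dg unfolding gderiv_def by (auto intro!: continuous_at_imp_continuous_on has_derivative_continuous)

lemma g_measurable [measurable]: "g \<in> borel_measurable borel" "Dg \<in> borel_measurable borel"
  using g_cont Dg_cont by (auto intro: borel_measurable_continuous_onI)

lemma gpowr_cont: "continuous_on UNIV (\<lambda>x. g x powr p)"
  using g_pos by (intro continuous_intros g_cont) (auto simp: less_imp_neq[symmetric])

section \<open>The inequality for a bounded target\<close>

definition "bump j x = cutoff j x * g x powr (1 - a)"
definition "Dbump j x = g x powr (1 - a) *\<^sub>R cutoff_grad j x + (cutoff j x * ((1 - a) * g x powr (- a))) *\<^sub>R Dg x"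

lemma C1_bump: "C1_bump (bump j) (Dbump j)"
  unfolding C1_bump_def
proof (intro conjI allI exI impI)
  show "0 \<le> bump j x" for x by (simp add: bump_def cutoff_nonneg)
  show "GDERIV (bump j) x :> Dbump j x" for x
  proof -
    have "((\<lambda>s. s powr (1 - a)) has_real_derivative (1 - a) * g x powr (- a)) (at (g x))"
      using has_real_derivative_powr[OF g_pos[of x], of "1 - a"] by simp
    from GDERIV_mult[OF cutoff_GDERIV GDERIV_DERIV_compose[OF Dg this], of j]
    show ?thesis unfolding bump_def[abs_def] Dbump_def
      by (rule GDERIV_subst) (simp add: add.commute)
  qed
  have "continuous_on UNIV (cutoff j :: 'a \<Rightarrow> real)"
    using cutoff_GDERIV[of j] unfolding gderiv_def
    by (auto intro!: continuous_at_imp_continuous_on has_derivative_continuous)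
  then show "continuous_on UNIV (Dbump j)"
    unfolding Dbump_def[abs_def] by (intro continuous_intros gpowr_cont Dg_cont cutoff_grad_continuous)
  show "bump j x = 0" "Dbump j x = 0" if "real (Suc j) < norm x" for x
    using cutoff_supp[OF that] by (simp_all add: bump_def Dbump_def)
qed

text \<open>\<open>v\<close> stands for the Legendre transform at the gradient times
  \<open>g powr (- a)\<close>: \<open>v_ge\<close> is Young's inequality, and \<open>vp\<close> is
  an integrable upper bound, since only the positive part of \<open>v\<close> is controlled
  beforehand. \<open>A\<close> occurs on the right because Young's inequality at \<open>T x\<close>
  costs \<open>W (T x)\<close>.\<close>

lemma transport_inequality:
  fixes E :: "'a set" and v vp :: "'a \<Rightarrow> real"
  defines "F \<equiv> \<lambda>x. indicator E x * W x powr (- a)"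
    and "F1 \<equiv> \<lambda>x. indicator E x * W x powr (1 - a)"
  defines "m \<equiv> \<integral>x. F x \<partial>lborel"
  defines "A \<equiv> (\<integral>x. F1 x \<partial>lborel) / m"
  assumes E[measurable]: "E \<in> sets borel" and E_bd: "\<And>x b. x \<in> E \<Longrightarrow> b \<in> Basis \<Longrightarrow> \<bar>x \<bullet> b\<bar> \<le> r" and r: "0 \<le> r"
    and F_int: "integrable lborel F" and F1_int: "integrable lborel F1" and m_pos: "0 < m"
    and v_meas[measurable]: "v \<in> borel_measurable borel"
    and vp_int: "integrable lborel vp" and v_vp: "AE x in lborel. v x \<le> vp x"
    and v_ge: "AE x in lborel. \<forall>z. (z \<bullet> Dg x - W z) * g x powr (- a) \<le> v x"
  shows "integrable lborel v"
    and "a * m powr (1 / a) * A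
      \<le> (a - real DIM('a)) * (\<integral>x. g x powr (1 - a) \<partial>lborel) + (a - 1) * ((\<integral>x. v x \<partial>lborel) + A)"
proof -
  define \<rho> where "\<rho> x = g x powr (- a)" for x
  define G where "G x = g x powr (1 - a)" for x
  define f where "f x = F x / m" for x
  have a_pos: "0 < a" using a_gt1 by simp
  have [measurable]: "F \<in> borel_measurable borel" "F1 \<in> borel_measurable borel" "vp \<in> borel_measurable borel"
    using F_int F1_int vp_int by auto
  have [measurable]: "\<rho> \<in> borel_measurable borel" "f \<in> borel_measurable borel" "G \<in> borel_measurable borel"
    unfolding \<rho>_def[abs_def] f_def[abs_def] G_def[abs_def] by measurable
  have \<rho>_pos: "0 < \<rho> x" and G_pos: "0 < G x" for x using g_pos[of x] by (simp_all add: \<rho>_def G_def)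
  have G_int: "integrable lborel G" using g1_int by (simp add: G_def[abs_def])
  have F_nn: "0 \<le> F x" and F1_nn: "0 \<le> F1 x" for x by (simp_all add: F_def F1_def)
  have \<rho>_one: "(\<integral>\<^sup>+x. ennreal (\<rho> x) \<partial>lborel) = 1"
    using g_int g_one by (subst nn_integral_eq_integral) (auto simp: \<rho>_def[abs_def])
  have f_one: "(\<integral>\<^sup>+x. ennreal (f x) \<partial>lborel) = 1"
    using F_int F_nn m_pos by (subst nn_integral_eq_integral) (auto simp: f_def[abs_def] m_def)
  obtain T where T[measurable]: "T \<in> borel_measurable borel"
    and T_bd: "\<And>x b. b \<in> Basis \<Longrightarrow> \<bar>T x \<bullet> b\<bar> \<le> r"
    and push: "\<And>h. h \<in> borel_measurable borel \<Longrightarrow>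
        (\<integral>\<^sup>+x. h (T x) * ennreal (\<rho> x) \<partial>lborel) = (\<integral>\<^sup>+y. h y * ennreal (f y) \<partial>lborel)"
    and kn: "\<And>u Du. C1_bump u Du \<Longrightarrow>
        0 \<le> (a - real DIM('a)) * (\<integral>x. u x \<partial>lborel) - (\<integral>x. Du x \<bullet> T x \<partial>lborel) \<and>
        (\<integral>\<^sup>+x. ennreal (a * u x * (\<rho> x / f (T x)) powr (1 / a)) \<partial>lborel)
          \<le> ennreal ((a - real DIM('a)) * (\<integral>x. u x \<partial>lborel) - (\<integral>x. Du x \<bullet> T x \<partial>lborel))"
  proof (rule knothe_transport[of \<rho> f r a])
    show "f x = 0" if "b \<in> Basis" "r < \<bar>x \<bullet> b\<bar>" for x b
    proof -
      have "x \<notin> E" using E_bd[of x b] that by auto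
      then show ?thesis by (simp add: f_def F_def)
    qed
    show "0 \<le> f x" for x using F_nn m_pos by (simp add: f_def)
  qed (use \<rho>_pos \<rho>_one f_one r a_DIM in auto)
  define \<tau> where "\<tau> = real DIM('a) * r"
  have \<tau>: "norm (T x) \<le> \<tau>" for x
  proof -
    have "norm (T x) \<le> (\<Sum>b\<in>Basis. \<bar>T x \<bullet> b\<bar>)" by (rule norm_le_l1)
    also have "\<dots> \<le> (\<Sum>b\<in>(Basis::'a set). r)" using T_bd by (rule sum_mono)
    finally show ?thesis by (simp add: \<tau>_def)
  qed
  have \<tau>_nn: "0 \<le> \<tau>" using r by (simp add: \<tau>_def)
  \<comment> \<open>The target density vanishes off \<open>E\<close>, and positivity of
    \<open>\<rho>\<close> turns zero source mass into a Lebesgue null set.\<close>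
  have TE: "AE x in lborel. T x \<in> E"
  proof -
    have "(\<integral>\<^sup>+x. indicator (-E) (T x) * ennreal (\<rho> x) \<partial>lborel) = (\<integral>\<^sup>+y. indicator (-E) y * ennreal (f y) \<partial>lborel)"
      by (rule push) measurable
    also have "\<dots> = (\<integral>\<^sup>+(y::'a). 0 \<partial>lborel)"
      by (rule nn_integral_cong) (simp add: f_def F_def indicator_def)
    finally have "(\<integral>\<^sup>+x. indicator (-E) (T x) * ennreal (\<rho> x) \<partial>lborel) = 0" by simp
    then have "AE x in lborel. indicator (-E) (T x) * ennreal (\<rho> x) = 0"
      by (subst (asm) nn_integral_0_iff_AE) measurable
    then show ?thesis
    proof eventually_elim
      case (elim x)
      then show ?case using \<rho>_pos[of x] by (cases "T x \<in> E") auto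
    qed
  qed
  \<comment> \<open>\<open>W\<close> itself need not be Borel, so it is recovered on
    \<open>E\<close> from the Borel function \<open>F\<close>.\<close>
  define WE where "WE y = F y powr (- 1 / a)" for y
  have WE: "WE y = W y" if "y \<in> E" for y
    using that W_pos[of y] a_pos by (simp add: WE_def F_def powr_powr)
  have [measurable]: "WE \<in> borel_measurable borel" unfolding WE_def[abs_def] by measurable
  define w where "w x = WE (T x) * \<rho> x" for x
  have w_nn: "0 \<le> w x" for x using \<rho>_pos[of x] by (simp add: w_def WE_def)
  have [measurable]: "w \<in> borel_measurable borel" unfolding w_def[abs_def] by measurable
  have A_nn: "0 \<le> A" using F1_nn m_pos unfolding A_def by (intro divide_nonneg_pos Bochner_Integration.integral_nonneg)
  have w: "integrable lborel w" "(\<integral>x. w x \<partial>lborel) = A"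
  proof -
    have "(\<integral>\<^sup>+x. ennreal (w x) \<partial>lborel) = (\<integral>\<^sup>+x. ennreal (WE (T x)) * ennreal (\<rho> x) \<partial>lborel)"
      by (simp add: w_def ennreal_mult WE_def \<rho>_def)
    also have "\<dots> = (\<integral>\<^sup>+y. ennreal (WE y) * ennreal (f y) \<partial>lborel)"
      by (rule push) measurable
    also have "\<dots> = (\<integral>\<^sup>+y. ennreal (F1 y / m) \<partial>lborel)"
    proof (rule nn_integral_cong)
      fix y
      have "W y * W y powr (- a) = W y powr (1 - a)"
        using W_pos[of y] by (simp add: powr_diff powr_minus field_simps)
      then have "WE y * f y = F1 y / m"
        by (cases "y \<in> E") (auto simp: WE f_def F_def F1_def)
      then show "ennreal (WE y) * ennreal (f y) = ennreal (F1 y / m)"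
        using F_nn m_pos by (simp add: ennreal_mult[symmetric] WE_def f_def)
    qed
    also have "\<dots> = ennreal A"
      using F1_int F1_nn m_pos by (subst nn_integral_eq_integral) (auto simp: A_def)
    finally have "(\<integral>\<^sup>+x. ennreal (w x) \<partial>lborel) = ennreal A" .
    then show "integrable lborel w" "(\<integral>x. w x \<partial>lborel) = A"
      using nn_integral_eq_integrable[of w lborel A] w_nn A_nn by auto
  qed
  define d where "d x = \<rho> x * (Dg x \<bullet> T x)" for x
  have [measurable]: "d \<in> borel_measurable borel" unfolding d_def[abs_def] by measurable
  have cut_d_int: "integrable lborel (\<lambda>x. cutoff j x * d x)" for j
  proof -
    have cc: "continuous_on UNIV (\<lambda>x. (cutoff j x * \<rho> x) *\<^sub>R Dg x)"
      using cutoff_GDERIV[of j] unfolding gderiv_def \<rho>_def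
      by (intro continuous_intros gpowr_cont Dg_cont)
        (auto intro!: continuous_at_imp_continuous_on has_derivative_continuous)
    obtain C where C: "\<And>x. norm ((cutoff j x * \<rho> x) *\<^sub>R Dg x) \<le> C"
      using continuous_compact_support_bounded[OF cc, of "real (Suc j)"] cutoff_supp(1)[of j] by (metis mult_zero_left scaleR_zero_left)
    show ?thesis
    proof (rule integrableI_bounded_set[where A="cball 0 (real (Suc j))" and B="C * \<tau>"])
      show "AE x in lborel. x \<in> cball 0 (real (Suc j)) \<longrightarrow> norm (cutoff j x * d x) \<le> C * \<tau>"
      proof (intro AE_I2 impI)
        fix x
        have "norm (cutoff j x * d x) = \<bar>((cutoff j x * \<rho> x) *\<^sub>R Dg x) \<bullet> T x\<bar>"
          by (simp add: d_def mult.assoc)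
        also have "\<dots> \<le> norm ((cutoff j x * \<rho> x) *\<^sub>R Dg x) * norm (T x)"
          by (rule Cauchy_Schwarz_ineq2)
        also have "\<dots> \<le> C * \<tau>"
          using C[of x] \<tau>[of x] norm_ge_zero order_trans by (intro mult_mono) blast+
        finally show "norm (cutoff j x * d x) \<le> C * \<tau>" .
      qed
      show "AE x in lborel. x \<notin> cball 0 (real (Suc j)) \<longrightarrow> cutoff j x * d x = 0"
        by (intro AE_I2 impI) (use cutoff_supp(1)[of j] in \<open>auto simp: not_le simp del: of_nat_Suc\<close>)
      show "emeasure lborel (cball 0 (real (Suc j)) :: 'a set) < \<infinity>"
        using emeasure_lborel_cball_finite by (auto simp: less_top)
    qed measurable
  qed
  have gT_le: "norm (G x * (cutoff_grad j x \<bullet> T x)) \<le> 4 * \<tau> / real (Suc j) * G x" for j x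
  proof -
    have "\<bar>cutoff_grad j x \<bullet> T x\<bar> \<le> norm (cutoff_grad j x) * norm (T x)" by (rule Cauchy_Schwarz_ineq2)
    also have "\<dots> \<le> 4 / real (Suc j) * \<tau>"
      using cutoff_grad_norm[of j x] \<tau>[of x] by (intro mult_mono) auto
    finally have "G x * \<bar>cutoff_grad j x \<bullet> T x\<bar> \<le> G x * (4 / real (Suc j) * \<tau>)"
      using G_pos[of x] by (intro mult_left_mono) auto
    also have "\<dots> = 4 * \<tau> / real (Suc j) * G x" by simp
    finally show ?thesis unfolding real_norm_def abs_mult abs_of_pos[OF G_pos] .
  qed
  have gT_int: "integrable lborel (\<lambda>x. G x * (cutoff_grad j x \<bullet> T x))" for j
    by (rule Bochner_Integration.integrable_bound[where f="\<lambda>x. 4 * \<tau> / real (Suc j) * G x"])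
      (use gT_le G_int order_trans[OF gT_le abs_ge_self] in auto)
  define B where "B j = (\<integral>x. G x * (cutoff_grad j x \<bullet> T x) \<partial>lborel)" for j
  have B_le: "\<bar>B j\<bar> \<le> 4 * \<tau> / real (Suc j) * (\<integral>x. G x \<partial>lborel)" for j
  proof -
    have "\<bar>B j\<bar> \<le> (\<integral>x. norm (G x * (cutoff_grad j x \<bullet> T x)) \<partial>lborel)"
      unfolding B_def using integral_norm_bound[of lborel "\<lambda>x. G x * (cutoff_grad j x \<bullet> T x)"] by simp
    also have "\<dots> \<le> (\<integral>x. 4 * \<tau> / real (Suc j) * G x \<partial>lborel)"
      by (rule integral_mono) (use gT_int gT_le G_int in auto)
    finally show ?thesis by simp
  qed
  have IG_nn: "0 \<le> (\<integral>x. G x \<partial>lborel)"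
    using G_pos by (intro Bochner_Integration.integral_nonneg) (simp add: less_imp_le)
  have B_lim: "B \<longlonglongrightarrow> 0"
  proof (rule Lim_null_comparison)
    show "eventually (\<lambda>j. norm (B j) \<le> 4 * \<tau> / real (Suc j) * (\<integral>x. G x \<partial>lborel)) sequentially"
      using B_le by simp
    show "(\<lambda>j. 4 * \<tau> / real (Suc j) * (\<integral>x. G x \<partial>lborel)) \<longlonglongrightarrow> 0"
      using tendsto_mult[OF tendsto_const[of "4 * \<tau> * (\<integral>x. G x \<partial>lborel)"] LIMSEQ_inverse_real_of_nat]
      by (simp add: divide_inverse mult_ac)
  qed
  \<comment> \<open>Besides the limit, a bound uniform in \<open>j\<close> is needed for the Fatou
    argument.\<close>
  have B_ge: "- (4 * \<tau> * (\<integral>x. G x \<partial>lborel)) \<le> B j" for j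
  proof -
    have "4 * \<tau> / real (Suc j) * (\<integral>x. G x \<partial>lborel) \<le> 4 * \<tau> * (\<integral>x. G x \<partial>lborel)"
      using \<tau>_nn IG_nn by (intro mult_right_mono) (auto simp: field_simps)
    then show ?thesis using B_le[of j] by linarith
  qed
  have main: "a * m powr (1 / a) * (\<integral>x. cutoff j x * w x \<partial>lborel)
      \<le> (a - real DIM('a)) * (\<integral>x. cutoff j x * G x \<partial>lborel) - B j + (a - 1) * (\<integral>x. cutoff j x * d x \<partial>lborel)" for j
  proof -
    let ?c = "a * m powr (1 / a)"
    have DT: "(\<integral>x. Dbump j x \<bullet> T x \<partial>lborel) = B j + (1 - a) * (\<integral>x. cutoff j x * d x \<partial>lborel)"
    proof -
      have "Dbump j x \<bullet> T x = G x * (cutoff_grad j x \<bullet> T x) + (1 - a) * (cutoff j x * d x)" for x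
        by (simp add: Dbump_def G_def d_def \<rho>_def inner_add_left)
      then show ?thesis using gT_int[of j] cut_d_int[of j] by (simp add: B_def)
    qed
    have "(\<integral>\<^sup>+x. ennreal (?c * (cutoff j x * w x)) \<partial>lborel)
       = (\<integral>\<^sup>+x. ennreal (a * bump j x * (\<rho> x / f (T x)) powr (1 / a)) \<partial>lborel)"
    proof (rule nn_integral_cong_AE)
      show "AE x in lborel. ennreal (?c * (cutoff j x * w x)) = ennreal (a * bump j x * (\<rho> x / f (T x)) powr (1 / a))"
        using TE
      proof eventually_elim
        case (elim x)
        have "\<rho> x / f (T x) = (m powr (1 / a) * (W (T x) / g x)) powr a"
          using g_pos[of x] W_pos[of "T x"] m_pos a_pos elim
          by (simp add: \<rho>_def f_def F_def powr_mult powr_divide powr_powr powr_minus field_simps)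
        then have pw: "(\<rho> x / f (T x)) powr (1 / a) = m powr (1 / a) * (W (T x) / g x)"
          using g_pos[of x] W_pos[of "T x"] m_pos a_pos by (simp add: powr_powr)
        have gg: "g x powr (1 - a) = g x * \<rho> x"
          using g_pos[of x] by (simp add: \<rho>_def powr_diff powr_minus field_simps)
        show ?case
          unfolding pw w_def WE[OF elim] bump_def gg using g_pos[of x] by (simp add: field_simps)
      qed
    qed
    also have "\<dots> \<le> ennreal ((a - real DIM('a)) * (\<integral>x. bump j x \<partial>lborel) - (\<integral>x. Dbump j x \<bullet> T x \<partial>lborel))"
      using kn[OF C1_bump] by blast
    finally have le: "(\<integral>\<^sup>+x. ennreal (?c * (cutoff j x * w x)) \<partial>lborel)
      \<le> ennreal ((a - real DIM('a)) * (\<integral>x. bump j x \<partial>lborel) - (\<integral>x. Dbump j x \<bullet> T x \<partial>lborel))" .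
    have "(\<integral>\<^sup>+x. ennreal (?c * (cutoff j x * w x)) \<partial>lborel) = ennreal (\<integral>x. ?c * (cutoff j x * w x) \<partial>lborel)"
      using cutoff_mult_integrable[OF w(1), of j] a_pos w_nn cutoff_nonneg
      by (intro nn_integral_eq_integral AE_I2 mult_nonneg_nonneg) auto
    with le have "?c * (\<integral>x. cutoff j x * w x \<partial>lborel)
      \<le> (a - real DIM('a)) * (\<integral>x. bump j x \<partial>lborel) - (\<integral>x. Dbump j x \<bullet> T x \<partial>lborel)"
      using kn[OF C1_bump, of j] by (simp add: ennreal_le_iff)
    then show ?thesis
      unfolding DT by (simp add: bump_def[abs_def] G_def algebra_simps)
  qed
  have dvw: "AE x in lborel. d x \<le> v x + w x"
    using TE v_ge
  proof eventually_elim
    case (elim x)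
    from elim(2) have "(T x \<bullet> Dg x - W (T x)) * \<rho> x \<le> v x" by (simp add: \<rho>_def)
    then show ?case using WE[OF elim(1)] by (simp add: d_def w_def algebra_simps inner_commute)
  qed
  \<comment> \<open>Integrability of \<open>d\<close> comes from Fatou for the nonnegative function \<open>y\<close>, as the inequality \<open>main\<close>
    bounds the truncated integrals of \<open>d\<close> from below.\<close>
  define y where "y x = vp x + w x - d x" for x
  have [measurable]: "y \<in> borel_measurable borel" unfolding y_def[abs_def] by measurable
  have y_nn: "AE x in lborel. 0 \<le> y x"
    using dvw v_vp by eventually_elim (simp add: y_def)
  \<comment> \<open>The last summand bounds minus the truncated integral of \<open>d\<close>: it is
    what \<open>main\<close> yields once its nonnegative left side is replaced by 0 and
    \<open>B j\<close> by its uniform lower bound.\<close>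
  define C where "C = (\<integral>x. \<bar>vp x\<bar> \<partial>lborel) + A + ((a - real DIM('a)) + 4 * \<tau>) * (\<integral>x. G x \<partial>lborel) / (a - 1)"
  have cut_y: "(\<integral>\<^sup>+x. ennreal (cutoff j x * y x) \<partial>lborel) \<le> ennreal C" for j
  proof -
    have i: "integrable lborel (\<lambda>x. cutoff j x * vp x)" "integrable lborel (\<lambda>x. cutoff j x * w x)"
      "integrable lborel (\<lambda>x. cutoff j x * G x)"
      using vp_int w(1) G_int by (auto intro!: cutoff_mult_integrable)
    have eq: "(\<integral>x. cutoff j x * y x \<partial>lborel) = (\<integral>x. cutoff j x * vp x \<partial>lborel) + (\<integral>x. cutoff j x * w x \<partial>lborel) - (\<integral>x. cutoff j x * d x \<partial>lborel)"
      using i cut_d_int[of j] by (simp add: y_def algebra_simps)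
    have iy: "integrable lborel (\<lambda>x. cutoff j x * y x)"
      using i cut_d_int[of j] by (simp add: y_def algebra_simps)
    have 1: "(\<integral>x. cutoff j x * vp x \<partial>lborel) \<le> (\<integral>x. \<bar>vp x\<bar> \<partial>lborel)"
      using i vp_int cutoff_mult_le[of j _ "vp _"] by (intro integral_mono) (auto simp: abs_le_iff)
    have 2: "(\<integral>x. cutoff j x * w x \<partial>lborel) \<le> A"
      unfolding w(2)[symmetric] using i w cutoff_mult_le[of j _ "w _"] w_nn by (intro integral_mono) (auto simp: abs_le_iff)
    have 3: "(\<integral>x. cutoff j x * G x \<partial>lborel) \<le> (\<integral>x. G x \<partial>lborel)"
      using i G_int G_pos by (intro integral_mono) (simp_all add: cutoff_le1)
    have 4: "0 \<le> (\<integral>x. cutoff j x * w x \<partial>lborel)"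
      by (intro Bochner_Integration.integral_nonneg mult_nonneg_nonneg w_nn cutoff_nonneg)
    have "0 \<le> a * m powr (1 / a) * (\<integral>x. cutoff j x * w x \<partial>lborel)"
      using 4 a_pos by simp
    also note main[of j]
    also have "(a - real DIM('a)) * (\<integral>x. cutoff j x * G x \<partial>lborel) \<le> (a - real DIM('a)) * (\<integral>x. G x \<partial>lborel)"
      using 3 a_DIM by (intro mult_left_mono) auto
    finally have "- ((a - real DIM('a)) + 4 * \<tau>) * (\<integral>x. G x \<partial>lborel) \<le> (a - 1) * (\<integral>x. cutoff j x * d x \<partial>lborel)"
      using B_ge[of j] by (simp add: algebra_simps)
    then have "- (\<integral>x. cutoff j x * d x \<partial>lborel) \<le> ((a - real DIM('a)) + 4 * \<tau>) * (\<integral>x. G x \<partial>lborel) / (a - 1)"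
      using a_gt1 by (simp add: pos_le_divide_eq algebra_simps)
    then have "(\<integral>x. cutoff j x * y x \<partial>lborel) \<le> C"
      unfolding eq C_def using 1 2 by linarith
    moreover have "(\<integral>\<^sup>+x. ennreal (cutoff j x * y x) \<partial>lborel) = ennreal (\<integral>x. cutoff j x * y x \<partial>lborel)"
    proof (rule nn_integral_eq_integral[OF iy])
      show "AE x in lborel. 0 \<le> cutoff j x * y x"
        using y_nn by eventually_elim (intro mult_nonneg_nonneg cutoff_nonneg)
    qed
    ultimately show ?thesis by (simp add: ennreal_leI)
  qed
  have "(\<integral>\<^sup>+x. ennreal (y x) \<partial>lborel) = (\<integral>\<^sup>+x. liminf (\<lambda>j. ennreal (cutoff j x * y x)) \<partial>lborel)"
  proof (rule nn_integral_cong)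
    fix x
    have "(\<lambda>j. cutoff j x * y x) \<longlonglongrightarrow> 1 * y x" by (intro tendsto_intros cutoff_LIMSEQ)
    then have "(\<lambda>j. ennreal (cutoff j x * y x)) \<longlonglongrightarrow> ennreal (y x)" by (intro tendsto_ennrealI) simp
    then show "ennreal (y x) = liminf (\<lambda>j. ennreal (cutoff j x * y x))"
      by (intro lim_imp_Liminf[symmetric]) auto
  qed
  also have "\<dots> \<le> liminf (\<lambda>j. \<integral>\<^sup>+x. ennreal (cutoff j x * y x) \<partial>lborel)"
    by (rule nn_integral_liminf) measurable
  also have "\<dots> \<le> liminf (\<lambda>j::nat. ennreal C)"
    by (rule Liminf_mono) (use cut_y in simp)
  also have "\<dots> = ennreal C" by (simp add: Liminf_const)
  finally have "(\<integral>\<^sup>+x. ennreal (y x) \<partial>lborel) < \<infinity>"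
    by (rule order_le_less_trans) simp
  then have y_int: "integrable lborel y"
    using y_nn by (intro integrableI_nonneg) auto
  have d_int: "integrable lborel d"
  proof -
    have "integrable lborel (\<lambda>x. vp x + w x - y x)" using vp_int w(1) y_int by simp
    then show ?thesis by (simp add: y_def)
  qed
  \<comment> \<open>Almost everywhere \<open>v\<close> lies between \<open>d - w\<close> and
    \<open>vp\<close>, so integrability of \<open>d\<close> supplies the missing control from
    below.\<close>
  show v_int: "integrable lborel v"
  proof (rule Bochner_Integration.integrable_bound)
    show "integrable lborel (\<lambda>x. \<bar>d x\<bar> + \<bar>w x\<bar> + \<bar>vp x\<bar>)" using d_int w(1) vp_int by simp
    show "AE x in lborel. norm (v x) \<le> norm (\<bar>d x\<bar> + \<bar>w x\<bar> + \<bar>vp x\<bar>)"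
      using dvw v_vp
    proof eventually_elim
      case (elim x)
      have "\<bar>v x\<bar> \<le> \<bar>d x\<bar> + \<bar>w x\<bar> + \<bar>vp x\<bar>"
        by (rule abs_leI) (use elim in linarith)+
      then show ?case by simp
    qed
  qed measurable
  have "a * m powr (1 / a) * A \<le> (a - real DIM('a)) * (\<integral>x. G x \<partial>lborel) - 0 + (a - 1) * (\<integral>x. d x \<partial>lborel)"
  proof (rule LIMSEQ_le)
    show "(\<lambda>j. a * m powr (1 / a) * (\<integral>x. cutoff j x * w x \<partial>lborel)) \<longlonglongrightarrow> a * m powr (1 / a) * A"
      unfolding w(2)[symmetric] by (intro tendsto_intros cutoff_integral_LIMSEQ w(1))
    show "(\<lambda>j. (a - real DIM('a)) * (\<integral>x. cutoff j x * G x \<partial>lborel) - B j + (a - 1) * (\<integral>x. cutoff j x * d x \<partial>lborel))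
      \<longlonglongrightarrow> (a - real DIM('a)) * (\<integral>x. G x \<partial>lborel) - 0 + (a - 1) * (\<integral>x. d x \<partial>lborel)"
      by (intro tendsto_intros cutoff_integral_LIMSEQ G_int d_int B_lim)
    show "\<exists>N. \<forall>j\<ge>N. a * m powr (1 / a) * (\<integral>x. cutoff j x * w x \<partial>lborel)
      \<le> (a - real DIM('a)) * (\<integral>x. cutoff j x * G x \<partial>lborel) - B j + (a - 1) * (\<integral>x. cutoff j x * d x \<partial>lborel)"
      using main by blast
  qed
  also have "(\<integral>x. d x \<partial>lborel) \<le> (\<integral>x. v x \<partial>lborel) + A"
  proof -
    have "(\<integral>x. d x \<partial>lborel) \<le> (\<integral>x. v x + w x \<partial>lborel)"
      using dvw d_int v_int w(1) by (intro integral_mono_AE) auto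
    then show ?thesis using v_int w by simp
  qed
  finally show "a * m powr (1 / a) * A
      \<le> (a - real DIM('a)) * (\<integral>x. g x powr (1 - a) \<partial>lborel) + (a - 1) * ((\<integral>x. v x \<partial>lborel) + A)"
    using a_gt1 by (simp add: G_def[abs_def])
qed

end

section \<open>Tangent planes of convex functions\<close>

lemma convex_above_tangent:
  fixes g :: "'a::euclidean_space \<Rightarrow> real"
  assumes conv: "convex_on UNIV g" and D: "GDERIV g x :> D"
  shows "g x + (z - x) \<bullet> D \<le> g z"
proof -
  define \<phi> where "\<phi> t = g (x + t *\<^sub>R (z - x))" for t :: real
  have \<phi>: "convex_on UNIV \<phi>"
  proof (rule convex_onI)
    fix t s s' :: real assume "0 < t" "t < 1"
    have "\<phi> ((1 - t) *\<^sub>R s + t *\<^sub>R s') = g ((1 - t) *\<^sub>R (x + s *\<^sub>R (z - x)) + t *\<^sub>R (x + s' *\<^sub>R (z - x)))"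
      unfolding \<phi>_def by (intro arg_cong[where f=g]) (simp add: algebra_simps)
    also have "\<dots> \<le> (1 - t) * \<phi> s + t * \<phi> s'"
      unfolding \<phi>_def using conv \<open>0 < t\<close> \<open>t < 1\<close> by (intro convex_onD) auto
    finally show "\<phi> ((1 - t) *\<^sub>R s + t *\<^sub>R s') \<le> (1 - t) * \<phi> s + t * \<phi> s'" .
  qed simp
  have "(\<phi> has_derivative (\<lambda>h. (h *\<^sub>R (z - x)) \<bullet> D)) (at 0)"
    unfolding \<phi>_def[abs_def]
    by (rule has_derivative_compose[where g=g and f="\<lambda>t. x + t *\<^sub>R (z - x)"])
      (use D in \<open>auto simp: gderiv_def intro!: derivative_eq_intros\<close>)
  then have "(\<phi> has_field_derivative (z - x) \<bullet> D) (at 0)"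
    unfolding has_field_derivative_def by (rule has_derivative_eq_rhs) (simp add: fun_eq_iff mult.commute)
  then have "((z - x) \<bullet> D) * (1 - 0) \<le> \<phi> 1 - \<phi> 0"
    by (intro convex_on_imp_above_tangent[OF \<phi>]) auto
  then show ?thesis by (simp add: \<phi>_def)
qed

lemma legendre_grad:
  fixes g :: "'a::euclidean_space \<Rightarrow> real"
  assumes "convex_on UNIV g" "GDERIV g x :> D"
  shows "legendre (\<lambda>z. ereal (g z)) D = ereal (x \<bullet> D - g x)"
proof (rule antisym)
  show "legendre (\<lambda>z. ereal (g z)) D \<le> ereal (x \<bullet> D - g x)"
    unfolding legendre_def
  proof (rule SUP_least)
    fix z
    show "ereal (z \<bullet> D) - ereal (g z) \<le> ereal (x \<bullet> D - g x)"
      using convex_above_tangent[OF assms, of z] by (simp add: inner_diff_left)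
  qed
qed (rule legendre_ge)

text \<open>As infinity minus infinity counts as infinity, a value below infinity forces the
  positive part to have finite integral, so \<open>f\<close> is almost nowhere
  \<open>\<infinity>\<close>. The negative part may still have infinite integral at this
  stage.\<close>

lemma ereal_integral_finite_pos_part:
  assumes [measurable]: "f \<in> borel_measurable borel" and fin: "ereal_integral lebesgue f < \<infinity>"
    and bot: "\<And>x. f x \<noteq> -\<infinity>"
  shows "AE x in lborel. f x = ereal (real_of_ereal (f x))"
    and "integrable lborel (\<lambda>x. max 0 (real_of_ereal (f x)))"
proof -
  have "(\<integral>\<^sup>+x. e2ennreal (f x) \<partial>lebesgue) \<noteq> \<infinity>"
    using fin by (auto simp: ereal_integral_def)
  then have fin': "(\<integral>\<^sup>+x. e2ennreal (f x) \<partial>lborel) \<noteq> \<infinity>"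
    by (subst (asm) nn_integral_completion) auto
  have "AE x in lborel. e2ennreal (f x) \<noteq> \<infinity>"
    by (rule nn_integral_PInf_AE[OF _ fin']) measurable
  then show AE: "AE x in lborel. f x = ereal (real_of_ereal (f x))"
  proof eventually_elim
    case (elim x)
    then show ?case using bot[of x] by (cases "f x") (auto simp: e2ennreal_infty)
  qed
  have pos: "ennreal y = ennreal (max 0 y)" for y :: real
    by (cases "0 \<le> y") (auto simp: ennreal_neg)
  have "(\<integral>\<^sup>+x. ennreal (max 0 (real_of_ereal (f x))) \<partial>lborel) = (\<integral>\<^sup>+x. e2ennreal (f x) \<partial>lborel)"
  proof (rule nn_integral_cong_AE)
    show "AE x in lborel. ennreal (max 0 (real_of_ereal (f x))) = e2ennreal (f x)"
      using AE
    proof eventually_elim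
      case (elim x)
      have "e2ennreal (f x) = e2ennreal (ereal (real_of_ereal (f x)))" using elim by simp
      also have "\<dots> = ennreal (real_of_ereal (f x))" by (simp flip: ennreal.abs_eq)
      also have "\<dots> = ennreal (max 0 (real_of_ereal (f x)))" by (rule pos)
      finally show ?case by simp
    qed
  qed
  then show "integrable lborel (\<lambda>x. max 0 (real_of_ereal (f x)))"
    using fin' by (intro integrableI_nonneg) (auto simp: less_top)
qed

section \<open>Exhausting the space, and the radial moment\<close>

context gradient_density
begin

text \<open>\<open>W powr (- a)\<close> agrees with a Borel function off a null set
  \<open>N\<close>, so the exhausting sets are balls with \<open>N\<close> cut out. Masses and
  integrals over them converge by dominated convergence, and the masses are eventually
  positive.\<close>

lemma transport_inequality_limit:
  fixes v vp :: "'a \<Rightarrow> real"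
  assumes W1: "integrable lebesgue (\<lambda>x. W x powr (1 - a))"
    and W0: "integrable lebesgue (\<lambda>x. W x powr (- a))" and W_one: "(LINT x|lebesgue. W x powr (- a)) = 1"
    and v: "v \<in> borel_measurable borel" "integrable lborel vp" "AE x in lborel. v x \<le> vp x"
      "AE x in lborel. \<forall>z. (z \<bullet> Dg x - W z) * g x powr (- a) \<le> v x"
  shows "integrable lborel v"
    and "(LINT x|lebesgue. W x powr (1 - a))
      \<le> (a - real DIM('a)) * (\<integral>x. g x powr (1 - a) \<partial>lborel) + (a - 1) * (\<integral>x. v x \<partial>lborel)"
proof -
  have "(\<lambda>x. W x powr (- a)) \<in> borel_measurable lebesgue" using W0 by auto
  then obtain W' where W'[measurable]: "W' \<in> borel_measurable borel" and "AE x in lborel. W x powr (- a) = W' x"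
    using completion_ex_borel_measurable_real[of "\<lambda>x. W x powr (- a)" lborel] by auto
  then obtain N where N: "N \<in> null_sets lborel" and "{x \<in> space lborel. W x powr (- a) \<noteq> W' x} \<subseteq> N"
    unfolding eventually_ae_filter by auto
  then have W'_eq: "W x powr (- a) = W' x" if "x \<notin> N" for x using that by auto
  have [measurable]: "N \<in> sets borel" using N by auto
  define E where "E k = cball 0 (real k) - N" for k :: nat
  have E[measurable]: "E k \<in> sets borel" for k by (simp add: E_def)
  have E_lim: "AE x in lebesgue. (\<lambda>k. indicator (E k) x * h x) \<longlonglongrightarrow> h x" for h :: "'a \<Rightarrow> real"
  proof -
    have "AE x in lborel. x \<notin> N" using N by (rule AE_not_in)
    then have "AE x in lebesgue. x \<notin> N" by (rule AE_completion)
    then show ?thesis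
    proof eventually_elim
      case (elim x)
      have "eventually (\<lambda>k. norm x \<le> real k) sequentially"
        by (meson eventually_at_top_linorder nat_le_real_less order_trans real_arch_simple of_nat_le_iff)
      then have "eventually (\<lambda>k. h x = indicator (E k) x * h x) sequentially"
        by eventually_elim (use elim in \<open>simp add: E_def\<close>)
      then show ?case by (rule Lim_transform_eventually[OF tendsto_const])
    qed
  qed
  have E_int: "integrable lborel (\<lambda>x. indicator (E k) x * h x)"
    and E_eq: "(\<integral>x. indicator (E k) x * h x \<partial>lborel) = (LINT x|lebesgue. indicator (E k) x * h x)"
    if "integrable lebesgue h" and [measurable]: "(\<lambda>x. indicator (E k) x * h x) \<in> borel_measurable borel"
    for k and h :: "'a \<Rightarrow> real"
  proof -
    have "integrable lebesgue (\<lambda>x. indicator (E k) x *\<^sub>R h x)"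
      using that(1) by (intro integrable_mult_indicator) auto
    then show "integrable lborel (\<lambda>x. indicator (E k) x * h x)"
      by (subst (asm) integrable_completion) auto
    show "(\<integral>x. indicator (E k) x * h x \<partial>lborel) = (LINT x|lebesgue. indicator (E k) x * h x)"
      by (rule integral_completion[symmetric]) simp
  qed
  have E_conv: "(\<lambda>k. \<integral>x. indicator (E k) x * h x \<partial>lborel) \<longlonglongrightarrow> (LINT x|lebesgue. h x)"
    if h: "integrable lebesgue h" and m: "\<And>k. (\<lambda>x. indicator (E k) x * h x) \<in> borel_measurable borel" for h :: "'a \<Rightarrow> real"
    unfolding E_eq[OF h m]
  proof (rule integral_dominated_convergence[where w="\<lambda>x. norm (h x)"])
    show "AE x in lebesgue. norm (indicator (E k) x * h x) \<le> norm (h x)" for k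
      by (rule AE_I2) (simp add: indicator_def)
    show "(\<lambda>x. indicator (E k) x * h x) \<in> borel_measurable lebesgue" for k
      using m[of k] by (simp add: measurable_completion)
  qed (use h E_lim in auto)
  have m0: "(\<lambda>x. indicator (E k) x * W x powr (- a)) \<in> borel_measurable borel" for k
  proof -
    have "(\<lambda>x. indicator (E k) x * W x powr (- a)) = (\<lambda>x. indicator (E k) x * W' x)"
      by (rule ext, rename_tac x, case_tac "x \<in> N") (simp_all add: indicator_def E_def W'_eq)
    then show ?thesis by simp
  qed
  have m1: "(\<lambda>x. indicator (E k) x * W x powr (1 - a)) \<in> borel_measurable borel" for k
  proof -
    \<comment> \<open>\<open>N\<close> was chosen for the exponent \<open>- a\<close>; writing the
      other power as a power of this one lets the same set serve for both.\<close>
    have pw: "W x powr (1 - a) = (W x powr (- a)) powr ((a - 1) / a)" for x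
      using a_gt1 by (simp add: powr_powr)
    have "(\<lambda>x. indicator (E k) x * W x powr (1 - a)) = (\<lambda>x. indicator (E k) x * W' x powr ((a - 1) / a))"
      by (rule ext, rename_tac x, case_tac "x \<in> N") (simp_all add: indicator_def E_def pw W'_eq)
    then show ?thesis by simp
  qed
  define m where "m k = (\<integral>x. indicator (E k) x * W x powr (- a) \<partial>lborel)" for k
  define A where "A k = (\<integral>x. indicator (E k) x * W x powr (1 - a) \<partial>lborel)" for k
  define c where "c = (a - real DIM('a)) * (\<integral>x. g x powr (1 - a) \<partial>lborel)"
  let ?A = "LINT x|lebesgue. W x powr (1 - a)"
  have m_lim: "m \<longlonglongrightarrow> 1" using E_conv[OF W0 m0] by (simp add: m_def[abs_def] W_one)
  have A_lim: "A \<longlonglongrightarrow> ?A" using E_conv[OF W1 m1] by (simp add: A_def[abs_def])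
  have m_pos: "eventually (\<lambda>k. 0 < m k) sequentially" by (rule order_tendstoD(1)[OF m_lim]) simp
  have ti: "integrable lborel v \<and> a * m k powr (1 / a) * (A k / m k) \<le> c + (a - 1) * ((\<integral>x. v x \<partial>lborel) + A k / m k)"
    if "0 < m k" for k
  proof -
    have bd: "\<bar>x \<bullet> b\<bar> \<le> real k" if "x \<in> E k" "b \<in> Basis" for x b
      using that Basis_le_norm[of b x] by (auto simp: E_def)
    show ?thesis
      using transport_inequality[OF E bd _ E_int[OF W0 m0] E_int[OF W1 m1] _ v] that
      unfolding m_def A_def c_def by auto
  qed
  obtain k0 where "0 < m k0" using eventually_happens'[OF sequentially_bot m_pos] by blast
  then show "integrable lborel v" using ti by blast
  \<comment> \<open>In the limit \<open>?A\<close> stands \<open>a\<close> times on the left and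
    \<open>a - 1\<close> times on the right; the difference is the claim.\<close>
  have "a * 1 powr (1 / a) * (?A / 1) \<le> c + (a - 1) * ((\<integral>x. v x \<partial>lborel) + ?A / 1)"
  proof (rule tendsto_le[OF sequentially_bot])
    show "(\<lambda>k. a * m k powr (1 / a) * (A k / m k)) \<longlonglongrightarrow> a * 1 powr (1 / a) * (?A / 1)"
      by (intro tendsto_intros m_lim A_lim) auto
    show "(\<lambda>k. c + (a - 1) * ((\<integral>x. v x \<partial>lborel) + A k / m k)) \<longlonglongrightarrow> c + (a - 1) * ((\<integral>x. v x \<partial>lborel) + ?A / 1)"
      by (intro tendsto_intros m_lim A_lim) auto
    show "eventually (\<lambda>k. a * m k powr (1 / a) * (A k / m k) \<le> c + (a - 1) * ((\<integral>x. v x \<partial>lborel) + A k / m k)) sequentially"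
      using m_pos by eventually_elim (use ti in blast)
  qed
  then show "?A \<le> (a - real DIM('a)) * (\<integral>x. g x powr (1 - a) \<partial>lborel) + (a - 1) * (\<integral>x. v x \<partial>lborel)"
    by (simp add: c_def algebra_simps)
qed

text \<open>This is \<open>integral_radial_divergence\<close> for \<open>bump j\<close> in the
  limit. The term with the gradient of the cut-off is dominated by
  \<open>4 * g x powr (1 - a)\<close> and tends to 0 pointwise.\<close>

lemma radial_moment:
  assumes e_int: "integrable lborel (\<lambda>x. g x powr (- a) * (Dg x \<bullet> x))"
  shows "(a - 1) * (\<integral>x. g x powr (- a) * (Dg x \<bullet> x) \<partial>lborel) = real DIM('a) * (\<integral>x. g x powr (1 - a) \<partial>lborel)"
proof -
  let ?e = "\<lambda>x. g x powr (- a) * (Dg x \<bullet> x)" and ?G = "\<lambda>x. g x powr (1 - a)"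
  let ?b = "\<lambda>j x. ?G x * (cutoff_grad j x \<bullet> x)"
  have b_le: "norm (?b j x) \<le> 4 * ?G x" for j x
    using mult_left_mono[OF cutoff_grad_inner[of j x], of "?G x"] by (simp add: abs_mult)
  have b_int: "integrable lborel (?b j)" for j
    by (rule Bochner_Integration.integrable_bound[where f="\<lambda>x. 4 * ?G x"])
      (use b_le g1_int in auto)
  have b_lim: "(\<lambda>j. \<integral>x. ?b j x \<partial>lborel) \<longlonglongrightarrow> (\<integral>x. 0 \<partial>(lborel :: 'a measure))"
  proof (rule integral_dominated_convergence[where w="\<lambda>x. 4 * ?G x"])
    show "AE x in lborel. (\<lambda>j. ?b j x) \<longlonglongrightarrow> 0"
    proof (rule AE_I2)
      fix x
      have "(\<lambda>j. ?b j x) \<longlonglongrightarrow> ?G x * (0 \<bullet> x)" by (intro tendsto_intros cutoff_grad_LIMSEQ)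
      then show "(\<lambda>j. ?b j x) \<longlonglongrightarrow> 0" by simp
    qed
    show "AE x in lborel. norm (?b j x) \<le> 4 * ?G x" for j by (rule AE_I2) (rule b_le)
  qed (use g1_int in auto)
  have eq: "real DIM('a) * (\<integral>x. cutoff j x * ?G x \<partial>lborel) + ((\<integral>x. ?b j x \<partial>lborel) + (1 - a) * (\<integral>x. cutoff j x * ?e x \<partial>lborel)) = 0" for j
  proof -
    have "(\<integral>x. Dbump j x \<bullet> x \<partial>lborel) = (\<integral>x. ?b j x + (1 - a) * (cutoff j x * ?e x) \<partial>lborel)"
      by (rule Bochner_Integration.integral_cong) (auto simp: Dbump_def inner_add_left)
    also have "\<dots> = (\<integral>x. ?b j x \<partial>lborel) + (1 - a) * (\<integral>x. cutoff j x * ?e x \<partial>lborel)"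
      using b_int[of j] cutoff_mult_integrable[OF e_int, of j] by simp
    finally show ?thesis
      using integral_radial_divergence[OF C1_bump[of j]] by (simp add: bump_def[abs_def])
  qed
  have "(\<lambda>j. real DIM('a) * (\<integral>x. cutoff j x * ?G x \<partial>lborel) + ((\<integral>x. ?b j x \<partial>lborel) + (1 - a) * (\<integral>x. cutoff j x * ?e x \<partial>lborel)))
    \<longlonglongrightarrow> real DIM('a) * (\<integral>x. ?G x \<partial>lborel) + ((\<integral>x. 0 \<partial>(lborel :: 'a measure)) + (1 - a) * (\<integral>x. ?e x \<partial>lborel))"
    by (intro tendsto_intros cutoff_integral_LIMSEQ g1_int e_int b_lim)
  then have "real DIM('a) * (\<integral>x. ?G x \<partial>lborel) + ((\<integral>x. 0 \<partial>(lborel :: 'a measure)) + (1 - a) * (\<integral>x. ?e x \<partial>lborel)) = 0"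
    unfolding eq by (simp add: LIMSEQ_const_iff)
  then show ?thesis by (simp add: algebra_simps)
qed

end

theorem theorem4:
  fixes a :: real and W g :: "real ^ 'n \<Rightarrow> real"
  assumes "a \<ge> real CARD('n)"
    and "CARD('n) = 1 \<Longrightarrow> a > 1"
    and "\<And>x. W x > 0"
    and "integrable lebesgue (\<lambda>x. W x powr (1 - a))"
    and "\<And>x. g x > 0"
    and "smooth g"
    and "ereal_integral lebesgue
           (\<lambda>x. legendre (\<lambda>z. ereal (W z)) (grad g x) * ereal (g x powr (- a))) < \<infinity>"
    and "integrable lebesgue (\<lambda>x. g x powr (1 - a))"
    and "integrable lebesgue (\<lambda>x. g x powr (- a))"
    and "(LINT x|lebesgue. g x powr (- a)) = 1"
    and "integrable lebesgue (\<lambda>x. W x powr (- a))"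
    and "(LINT x|lebesgue. W x powr (- a)) = 1"
  shows "ereal (a - 1) * ereal_integral lebesgue
             (\<lambda>x. legendre (\<lambda>z. ereal (W z)) (grad g x) * ereal (g x powr (- a)))
           + ereal ((a - real CARD('n)) * (LINT x|lebesgue. g x powr (1 - a)))
         \<ge> ereal (LINT x|lebesgue. W x powr (1 - a))
       \<and> (g = W \<and> convex_on UNIV g \<longrightarrow>
           ereal (a - 1) * ereal_integral lebesgue
             (\<lambda>x. legendre (\<lambda>z. ereal (W z)) (grad g x) * ereal (g x powr (- a)))
           + ereal ((a - real CARD('n)) * (LINT x|lebesgue. g x powr (1 - a)))
         = ereal (LINT x|lebesgue. W x powr (1 - a)))"
proof -
  note D = smooth_GDERIV[OF \<open>smooth g\<close>] and Dc = smooth_grad_continuous[OF \<open>smooth g\<close>]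
  have gc: "continuous_on UNIV g"
    using D unfolding gderiv_def by (auto intro!: continuous_at_imp_continuous_on has_derivative_continuous)
  have [measurable]: "g \<in> borel_measurable borel" "grad g \<in> borel_measurable borel"
    using gc Dc by (auto intro: borel_measurable_continuous_onI)
  have "1 < a"
  proof (cases "CARD('n) = 1")
    case False
    then have "2 \<le> CARD('n)" using zero_less_card_finite[where 'a='n] by linarith
    then show ?thesis using assms(1) by linarith
  qed (rule assms(2))
  interpret gradient_density a W g "grad g"
  proof
    show "integrable lborel (\<lambda>x. g x powr (1 - a))" "integrable lborel (\<lambda>x. g x powr (- a))"
      using assms(8,9) by (simp_all add: integrable_completion)
    show "(\<integral>x. g x powr (- a) \<partial>lborel) = 1"
      using assms(10) by (simp add: integral_completion)
  qed (use assms(1,3,5) \<open>1 < a\<close> D Dc in auto)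
  let ?V = "legendre (\<lambda>z. ereal (W z))"
  let ?f = "\<lambda>x. ?V (grad g x) * ereal (g x powr (- a))"
  define v where "v x = real_of_ereal (?f x)" for x
  have V_bot: "?V y \<noteq> -\<infinity>" for y using legendre_ge[of 0 y W] by auto
  have f_meas[measurable]: "?f \<in> borel_measurable borel" by measurable
  have f_bot: "?f x \<noteq> -\<infinity>" for x
    using V_bot[of "grad g x"] g_pos[of x] by (cases "?V (grad g x)") auto
  note pp = ereal_integral_finite_pos_part[OF f_meas assms(7) f_bot, folded v_def]
  have v_meas[measurable]: "v \<in> borel_measurable borel" unfolding v_def[abs_def] by measurable
  have v_ge: "AE x in lborel. \<forall>z. (z \<bullet> grad g x - W z) * g x powr (- a) \<le> v x"
    using pp(1)
  proof eventually_elim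
    case (elim x)
    show ?case
    proof
      fix z
      have "ereal (z \<bullet> grad g x - W z) * ereal (g x powr (- a)) \<le> ?f x"
        by (intro ereal_mult_right_mono legendre_ge) simp
      then show "(z \<bullet> grad g x - W z) * g x powr (- a) \<le> v x" unfolding elim by simp
    qed
  qed
  \<comment> \<open>The positive part serves as the upper bound \<open>vp\<close>. Integrability of
    \<open>v\<close> itself is then a conclusion, and it makes the extended integral of
    \<open>?f\<close> a real number.\<close>
  have "AE x in lborel. v x \<le> max 0 (v x)" by simp
  note lim = transport_inequality_limit[OF assms(4,11,12) v_meas pp(2) this v_ge]
  have I: "ereal_integral lebesgue ?f = ereal (\<integral>x. v x \<partial>lborel)"
    using lim(1) pp(1) by (rule ereal_integral_AE_real)
  have G: "(LINT x|lebesgue. g x powr (1 - a)) = (\<integral>x. g x powr (1 - a) \<partial>lborel)"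
    by (rule integral_completion) measurable
  have eq: "(a - 1) * (\<integral>x. v x \<partial>lborel) + (a - real CARD('n)) * (\<integral>x. g x powr (1 - a) \<partial>lborel)
      = (\<integral>x. g x powr (1 - a) \<partial>lborel)" if "g = W" "convex_on UNIV g"
  proof -
    have "?V (grad g x) = ereal (x \<bullet> grad g x - g x)" for x
      using legendre_grad[OF that(2) D] that(1) by simp
    then have "v x = g x powr (- a) * (grad g x \<bullet> x) - g x * g x powr (- a)" for x
      by (simp add: v_def algebra_simps inner_commute)
    moreover have "g x * g x powr (- a) = g x powr (1 - a)" for x
      using g_pos[of x] by (simp add: powr_diff powr_minus field_simps)
    ultimately have v_eq: "v x = g x powr (- a) * (grad g x \<bullet> x) - g x powr (1 - a)" for x by simp
    \<comment> \<open>Integrability of the radial moment is not among the hypotheses; it is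
      inherited from \<open>v\<close> through \<open>lim(1)\<close>.\<close>
    have "integrable lborel (\<lambda>x. v x + g x powr (1 - a))" using lim(1) g1_int by simp
    then have e_int: "integrable lborel (\<lambda>x. g x powr (- a) * (grad g x \<bullet> x))" by (simp add: v_eq)
    have v_split: "(\<integral>x. v x \<partial>lborel) = (\<integral>x. g x powr (- a) * (grad g x \<bullet> x) \<partial>lborel) - (\<integral>x. g x powr (1 - a) \<partial>lborel)"
      unfolding v_eq using e_int g1_int by simp
    \<comment> \<open>\<open>radial_moment\<close> turns \<open>a - 1\<close> times the integral of
      \<open>v\<close> into \<open>real CARD('n) - (a - 1)\<close> copies of the integral of
      \<open>g x powr (1 - a)\<close>; adding \<open>a - real CARD('n)\<close> copies leaves
      one.\<close>
    show ?thesis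
      unfolding v_split right_diff_distrib radial_moment[OF e_int] by (simp add: algebra_simps)
  qed
  show ?thesis
  proof (intro conjI impI)
    assume gW: "g = W \<and> convex_on UNIV g"
    then have WG: "(LINT x|lebesgue. W x powr (1 - a)) = (\<integral>x. g x powr (1 - a) \<partial>lborel)" using G by simp
    show "ereal (a - 1) * ereal_integral lebesgue ?f + ereal ((a - real CARD('n)) * (LINT x|lebesgue. g x powr (1 - a)))
        = ereal (LINT x|lebesgue. W x powr (1 - a))"
      unfolding I G WG using eq[OF conjunct1[OF gW] conjunct2[OF gW]] by simp
  qed (use lim(2) in \<open>simp add: I G add.commute\<close>)
qed

end
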